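(* There is an absolute constant $K$ such that the following holds. Let $\mathcal M$ be any legitimate model of order $n$ of the class of Boolean circuits over $\{\neg,\wedge_2,\vee_2\}$ with $\overline{\neg}=\neg$, and let $f\in\mathcal F_n$, $s,k,m\ge 1$. 1. If $\rho(f,\mathcal M)\ge s$, then $f$ is not computable by any oracle circuit of size $s-Kknm$ using connectives $\neg,\wedge_2,\vee_2$ and $k$ oracle gates of arity $m$. 2. If $\rho(f,\mathcal M)\ge s$ and $\mathcal M$ is $0$-projective, then $f$ is not computable by any oracle circuit of size $s-Kkm^2$ using connectives $\neg,\wedge_2,\vee_2$ and $k$ oracle gates of arity $m$ all of whose inputs are among $\{x_1,\neg x_1,\dots,x_n,\neg x_n\}$. 3. If $\rho(f,\mathcal M)\ge s$ and $\mathcal M$ is projective, then $f$ is not computable by any oracle circuit of size $s-Kkm^2$ using connectives $\neg,\wedge_2,\vee_2$ and $k$ oracle gates of arity $m$.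
   Context: $\mathcal F_n$ is the set of Boolean functions $\{0,1\}^n\to\{0,1\}$, identified with their sets of ones; $\oplus$ is symmetric difference. Circuits over $\{\neg,\wedge_2,\vee_2\}$ are Boolean circuits with inputs $x_1,\dots,x_n$, constants, and gates labeled by negation, binary AND, binary OR; size = number of gates. An oracle circuit of size $S$ using $\neg,\wedge_2,\vee_2$ and $k$ oracle gates of arity $m$ is such a circuit in which, in addition, $k$ of its gates are oracle gates, each with $m$ ordered inputs and labeled by an arbitrary function $\{0,1\}^m\to\{0,1\}$ (possibly different for different gates and not necessarily symmetric); the size counts all gates. A legitimate model of order $n$ is a set $\mathcal M$ with $\{0,1,x_1,\dots,x_n\}\subseteq\mathcal M\subseteq\mathcal F_n$ with commutative operations $\overline\neg:\mathcal M\to\mathcal M$, $\overline{\wedge_2},\overline{\vee_2}:\mathcal M^2\to\mathcal M$; "$\overline\neg=\neg$" means $\mathcal M$ is closed under complement and $\overline\neg h=\neg h$. For a circuit $C$ over $\{\neg,\wedge_2,\vee_2\}$ and $f_1,\dots,f_r\in\mathcal M$, $\overline C(f_1,\dots,f_r)$ is defined inductively by replacing the inputs $x_i$ by $f_i$, constants by themselves, and each gate $\circ(C_1,\dots,C_j)$ by $\overline\circ$ applied to the approximations of $C_1,\dots,C_j$; $\overline C:=\overline C(x_1,\dots,x_n)$. Error sets: $\delta_\circ(f_1,\dots,f_j):=\circ(f_1,\dots,f_j)\oplus\overline\circ(f_1,\dots,f_j)$. $\rho(f,\mathcal M)$ is the minimal $t$ such that there exist $g\in\mathcal M$ and $t$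 tuples $(\circ_i,f^i_1,\dots,f^i_{m_i})$, $\circ_i\in\{\neg,\wedge_2,\vee_2\}$ of arity $m_i$, $f^i_j\in\mathcal M$, with $f\oplus g\subseteq\bigcup_i\delta_{\circ_i}(f^i_1,\dots,f^i_{m_i})$ ($\infty$ if none). $\mathcal M$ is $0$-projective if for every circuit $C$ over $\{\neg,\wedge_2,\vee_2\}$ with inputs among $\{x_j:j\in J\}$, $J\subseteq[n]$, and all $z,y\in\{0,1\}^n$ agreeing on $J$, $\overline C(z)=\overline C(y)$. $\mathcal M$ is projective if for every circuit $C$ over $\{\neg,\wedge_2,\vee_2\}$ with inputs $x_1,\dots,x_r$, all $f_1,\dots,f_r\in\mathcal M$ and all $z,y\in\{0,1\}^n$ with $f_i(z)=f_i(y)$ for all $i\le r$, we have $\overline C(f_1,\dots,f_r)(z)=\overline C(f_1,\dots,f_r)(y)$. *)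

theory Defs
  imports Main "HOL-Library.Extended_Nat"
begin

section \<open>Boolean functions\<close>

text \<open>
  Points of the cube are bit lists, coordinates are counted from 0, and a Boolean
  function is its set of ones.
\<close>

definition cube :: "nat \<Rightarrow> bool list set" where
  "cube n = {z. length z = n}"

type_synonym boolfun = "bool list set"

definition boolfuns :: "nat \<Rightarrow> boolfun set" where
  "boolfuns n = Pow (cube n)"

definition var :: "nat \<Rightarrow> nat \<Rightarrow> boolfun" where
  "var n i = {z \<in> cube n. z ! i}"

definition const :: "nat \<Rightarrow> bool \<Rightarrow> boolfun" where
  "const n b = (if b then cube n else {})"


section \<open>Circuits\<close>

text \<open>
  Circuits are directed acyclic graphs with unrestricted fan-out, given as a list of
  gates in topological order together with an output wire.  The wire \<open>Gate j\<close> carries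
  the value of the \<open>j\<close>-th gate of the list.  Input variables and constants are not
  gates.  An element of \<open>'a conn\<close> is a connective together with its arguments.
\<close>

datatype wire = Inp nat | Const bool | Gate nat

datatype 'a conn = Neg 'a | Conj 'a 'a | Disj 'a 'a

type_synonym circuit = "wire conn list \<times> wire"

datatype ogate = Conn "wire conn" | Oracle "bool list \<Rightarrow> bool" "wire list"

type_synonym ocircuit = "ogate list \<times> wire"

fun wires :: "ogate \<Rightarrow> wire set" where
  "wires (Conn c) = set_conn c"
| "wires (Oracle \<phi> ws) = set ws"

text \<open>The wire may be used when the first \<open>t\<close> gates are available and only the
  input variables with index in \<open>J\<close> are allowed.\<close>

fun wire_ok :: "nat set \<Rightarrow> nat \<Rightarrow> wire \<Rightarrow> bool" where
  "wire_ok J t (Inp i) \<longleftrightarrow> i \<in> J"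
| "wire_ok J t (Const b) \<longleftrightarrow> True"
| "wire_ok J t (Gate j) \<longleftrightarrow> j < t"

definition circuit_over :: "nat set \<Rightarrow> circuit \<Rightarrow> bool" where
  "circuit_over J C \<longleftrightarrow>
     (\<forall>t < length (fst C). \<forall>w \<in> set_conn (fst C ! t). wire_ok J t w) \<and>
     wire_ok J (length (fst C)) (snd C)"

definition ocircuit_over :: "nat set \<Rightarrow> ocircuit \<Rightarrow> bool" where
  "ocircuit_over J C \<longleftrightarrow>
     (\<forall>t < length (fst C). \<forall>w \<in> wires (fst C ! t). wire_ok J t w) \<and>
     wire_ok J (length (fst C)) (snd C)"

definition size_of :: "ocircuit \<Rightarrow> nat" where
  "size_of C = length (fst C)"

fun is_oracle :: "ogate \<Rightarrow> bool" where
  "is_oracle (Conn c) \<longleftrightarrow> False"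
| "is_oracle (Oracle \<phi> ws) \<longleftrightarrow> True"

definition oracle_circuit :: "nat \<Rightarrow> nat \<Rightarrow> nat \<Rightarrow> ocircuit \<Rightarrow> bool" where
  "oracle_circuit n k m C \<longleftrightarrow>
     ocircuit_over {..<n} C \<and>
     length (filter is_oracle (fst C)) = k \<and>
     (\<forall>\<phi> ws. Oracle \<phi> ws \<in> set (fst C) \<longrightarrow> length ws = m)"

text \<open>Negated variables are not free: they are supplied by negation gates, which
  count towards the size.\<close>

definition literal_wire :: "ocircuit \<Rightarrow> wire \<Rightarrow> bool" where
  "literal_wire C w \<longleftrightarrow>
     (\<exists>i. w = Inp i) \<or>
     (\<exists>i j. w = Gate j \<and> j < length (fst C) \<and> fst C ! j = Conn (Neg (Inp i)))"

definition literal_oracles :: "ocircuit \<Rightarrow> bool" where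
  "literal_oracles C \<longleftrightarrow>
     (\<forall>\<phi> ws. Oracle \<phi> ws \<in> set (fst C) \<longrightarrow> (\<forall>w \<in> set ws. literal_wire C w))"


section \<open>Evaluation\<close>

fun wire_val :: "(nat \<Rightarrow> 'a) \<Rightarrow> (bool \<Rightarrow> 'a) \<Rightarrow> 'a list \<Rightarrow> wire \<Rightarrow> 'a" where
  "wire_val inp cst vs (Inp i) = inp i"
| "wire_val inp cst vs (Const b) = cst b"
| "wire_val inp cst vs (Gate j) = vs ! j"

text \<open>The list of values of all gates, where \<open>step vs g\<close> is the value of the gate \<open>g\<close>
  when \<open>vs\<close> are the values of the gates preceding it.\<close>

definition run :: "('a list \<Rightarrow> 'g \<Rightarrow> 'a) \<Rightarrow> 'g list \<Rightarrow> 'a list" where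
  "run step gs = fold (\<lambda>g vs. vs @ [step vs g]) gs []"

fun bool_conn :: "bool conn \<Rightarrow> bool" where
  "bool_conn (Neg a) = (\<not> a)"
| "bool_conn (Conj a b) = (a \<and> b)"
| "bool_conn (Disj a b) = (a \<or> b)"

fun ogate_val :: "bool list \<Rightarrow> bool list \<Rightarrow> ogate \<Rightarrow> bool" where
  "ogate_val z vs (Conn c) = bool_conn (map_conn (wire_val ((!) z) id vs) c)"
| "ogate_val z vs (Oracle \<phi> ws) = \<phi> (map (wire_val ((!) z) id vs) ws)"

definition ocircuit_val :: "ocircuit \<Rightarrow> bool list \<Rightarrow> bool" where
  "ocircuit_val C z = wire_val ((!) z) id (run (ogate_val z) (fst C)) (snd C)"

definition computes :: "nat \<Rightarrow> ocircuit \<Rightarrow> boolfun \<Rightarrow> bool" where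
  "computes n C f \<longleftrightarrow> {z \<in> cube n. ocircuit_val C z} = f"


section \<open>Legitimate models\<close>

record model =
  members :: "boolfun set"
  mneg :: "boolfun \<Rightarrow> boolfun"
  mconj :: "boolfun \<Rightarrow> boolfun \<Rightarrow> boolfun"
  mdisj :: "boolfun \<Rightarrow> boolfun \<Rightarrow> boolfun"

definition legitimate :: "nat \<Rightarrow> model \<Rightarrow> bool" where
  "legitimate n M \<longleftrightarrow>
     members M \<subseteq> boolfuns n \<and>
     (\<forall>b. const n b \<in> members M) \<and>
     (\<forall>i<n. var n i \<in> members M) \<and>
     (\<forall>f \<in> members M. mneg M f \<in> members M) \<and>
     (\<forall>f \<in> members M. \<forall>g \<in> members M.
        mconj M f g \<in> members M \<and> mconj M f g = mconj M g f \<and>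
        mdisj M f g \<in> members M \<and> mdisj M f g = mdisj M g f)"

definition exact_neg :: "nat \<Rightarrow> model \<Rightarrow> bool" where
  "exact_neg n M \<longleftrightarrow>
     (\<forall>h \<in> members M. cube n - h \<in> members M \<and> mneg M h = cube n - h)"

fun exact_conn :: "nat \<Rightarrow> boolfun conn \<Rightarrow> boolfun" where
  "exact_conn n (Neg f) = cube n - f"
| "exact_conn n (Conj f g) = f \<inter> g"
| "exact_conn n (Disj f g) = f \<union> g"

fun approx_conn :: "model \<Rightarrow> boolfun conn \<Rightarrow> boolfun" where
  "approx_conn M (Neg f) = mneg M f"
| "approx_conn M (Conj f g) = mconj M f g"
| "approx_conn M (Disj f g) = mdisj M f g"

definition error_set :: "nat \<Rightarrow> model \<Rightarrow> boolfun conn \<Rightarrow> boolfun" where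
  "error_set n M c = sym_diff (exact_conn n c) (approx_conn M c)"

text \<open>The infimum of the empty set is \<open>\<infinity>\<close> in \<open>enat\<close>.\<close>

definition rho :: "nat \<Rightarrow> boolfun \<Rightarrow> model \<Rightarrow> enat" where
  "rho n f M = Inf {enat (length cs) | cs.
     (\<forall>c \<in> set cs. set_conn c \<subseteq> members M) \<and>
     (\<exists>g \<in> members M. sym_diff f g \<subseteq> (\<Union>c \<in> set cs. error_set n M c))}"

definition approx_circuit :: "nat \<Rightarrow> model \<Rightarrow> boolfun list \<Rightarrow> circuit \<Rightarrow> boolfun" where
  "approx_circuit n M fs C =
     (let inp = (!) fs; cst = const n
      in wire_val inp cst
           (run (\<lambda>vs c. approx_conn M (map_conn (wire_val inp cst vs) c)) (fst C)) (snd C))"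

definition zero_projective :: "nat \<Rightarrow> model \<Rightarrow> bool" where
  "zero_projective n M \<longleftrightarrow>
     (\<forall>J C z y. J \<subseteq> {..<n} \<longrightarrow> circuit_over J C \<longrightarrow>
        z \<in> cube n \<longrightarrow> y \<in> cube n \<longrightarrow> (\<forall>j \<in> J. z ! j = y ! j) \<longrightarrow>
        (z \<in> approx_circuit n M (map (var n) [0..<n]) C \<longleftrightarrow>
         y \<in> approx_circuit n M (map (var n) [0..<n]) C))"

definition projective :: "nat \<Rightarrow> model \<Rightarrow> bool" where
  "projective n M \<longleftrightarrow>
     (\<forall>fs C z y. set fs \<subseteq> members M \<longrightarrow> circuit_over {..<length fs} C \<longrightarrow>
        z \<in> cube n \<longrightarrow> y \<in> cube n \<longrightarrow> (\<forall>f \<in> set fs. z \<in> f \<longleftrightarrow> y \<in> f) \<longrightarrow>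
        (z \<in> approx_circuit n M fs C \<longleftrightarrow> y \<in> approx_circuit n M fs C))"

end

theory Submission
  imports Defs Complex_Main
begin

text \<open>
  Replace the gates of an oracle circuit one by one by their approximations: an ordinary gate
  costs one error set, so everything rests on approximating
  \<open>\<phi>(f\<^sub>1, \<dots>, f\<^sub>m)\<close> for members \<open>f\<^sub>i\<close> of the model at the cost of \<open>O(Nm)\<close> error sets, where
  \<open>2\<^sup>N\<close> bounds the number of points that the functions involved can distinguish: \<open>N = n\<close> in
  general, and \<open>N = m\<close> for functions built from the \<open>f\<^sub>i\<close> in a projective model.

  Approximate the decision tree of every \<open>h : {0,1}\<^sup>m \<rightarrow> {0,1}\<close>.  At a point \<open>z\<close> only the
  \<open>m\<close> nodes on the path of \<open>z\<close> matter, and for random \<open>h\<close> each of them is a random node of its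
  level.  Hence a greedy choice of \<open>O(Nm)\<close> nodes covers all points at which more than a small
  fraction of the trees are wrong.  At the other points \<open>\<phi> = h \<oplus> (h \<oplus> \<phi>)\<close> is computed
  correctly from the trees of \<open>h\<close> and \<open>h \<oplus> \<phi>\<close> for most \<open>h\<close>, and the majority vote of
  \<open>O(N)\<close> suitable \<open>h\<close>, taken by a counter with \<open>O(N)\<close> gates, is correct at all of them.
\<close>

section \<open>Counting and greedy choices\<close>

lemma finite_cube: "finite (cube n)" and card_cube: "card (cube n) = 2 ^ n"
  using finite_lists_length_eq[of "UNIV :: bool set" n] card_lists_length_eq[of "UNIV :: bool set" n]
  by (simp_all add: cube_def)

lemma finite_boolfuns: "finite (boolfuns n)"
  by (simp add: boolfuns_def finite_cube)

lemma card_boolfuns: "card (boolfuns n) = 2 ^ 2 ^ n"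
  by (simp add: boolfuns_def card_Pow finite_cube card_cube)

text \<open>A function of \<open>m + 1\<close> bits amounts to a pair of cofactors, one per value of
  the first bit. Hence the cofactor at \<open>b\<close> of a uniformly random function is again
  uniformly random, put here as a count.\<close>

lemma card_boolfuns_cofactor:
  "card {h \<in> boolfuns (Suc m). P {a. (b # a) \<in> h}} =
     card {p \<in> boolfuns m. P p} * card (boolfuns m)"
proof -
  have "bij_betw (\<lambda>h. ({a. b # a \<in> h}, {a. (\<not> b) # a \<in> h}))
      {h \<in> boolfuns (Suc m). P {a. b # a \<in> h}} ({p \<in> boolfuns m. P p} \<times> boolfuns m)"
  proof (rule bij_betw_byWitness[where f' = "\<lambda>(p, q). (#) b ` p \<union> (#) (\<not> b) ` q"])
    show "\<forall>h\<in>{h \<in> boolfuns (Suc m). P {a. b # a \<in> h}}.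
        (case ({a. b # a \<in> h}, {a. (\<not> b) # a \<in> h}) of (p, q) \<Rightarrow> (#) b ` p \<union> (#) (\<not> b) ` q) = h"
    proof
      fix h assume h: "h \<in> {h \<in> boolfuns (Suc m). P {a. b # a \<in> h}}"
      have "x \<in> (#) b ` {a. b # a \<in> h} \<union> (#) (\<not> b) ` {a. (\<not> b) # a \<in> h} \<longleftrightarrow> x \<in> h" for x
      proof (cases x)
        case Nil
        with h show ?thesis by (auto simp: boolfuns_def cube_def)
      next
        case (Cons d a)
        then show ?thesis by (cases "d = b") auto
      qed
      then show "(case ({a. b # a \<in> h}, {a. (\<not> b) # a \<in> h}) of
          (p, q) \<Rightarrow> (#) b ` p \<union> (#) (\<not> b) ` q) = h"
        by (simp add: set_eq_iff)
    qed
    show "\<forall>x\<in>{p \<in> boolfuns m. P p} \<times> boolfuns m.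
        ({a. b # a \<in> (case x of (p, q) \<Rightarrow> (#) b ` p \<union> (#) (\<not> b) ` q)},
         {a. (\<not> b) # a \<in> (case x of (p, q) \<Rightarrow> (#) b ` p \<union> (#) (\<not> b) ` q)}) = x"
      by (auto simp: image_iff)
    have aux: "{a. b # a \<in> (#) b ` p \<union> (#) (\<not> b) ` q} = p" for p q
      by auto
    show "(\<lambda>(p, q). (#) b ` p \<union> (#) (\<not> b) ` q) ` ({p \<in> boolfuns m. P p} \<times> boolfuns m)
        \<subseteq> {h \<in> boolfuns (Suc m). P {a. b # a \<in> h}}"
    proof (rule image_subsetI)
      fix x assume "x \<in> {p \<in> boolfuns m. P p} \<times> boolfuns m"
      then obtain p q where x: "x = (p, q)" "p \<in> boolfuns m" "P p" "q \<in> boolfuns m"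
        by auto
      then have "(#) b ` p \<union> (#) (\<not> b) ` q \<in> boolfuns (Suc m)"
        by (auto simp: boolfuns_def cube_def)
      with \<open>P p\<close> show "(\<lambda>(p, q). (#) b ` p \<union> (#) (\<not> b) ` q) x
          \<in> {h \<in> boolfuns (Suc m). P {a. b # a \<in> h}}"
        by (simp only: x(1) mem_Collect_eq prod.case aux)
    qed
  qed (auto simp: boolfuns_def cube_def)
  then show ?thesis
    by (simp add: bij_betw_same_card card_cartesian_product)
qed

text \<open>Choosing a set that hits a fraction \<open>c\<close> of what is still uncovered leaves
  at most a fraction \<open>1 - c\<close> of it.\<close>

lemma greedy_cover:
  fixes c :: real
  assumes "finite Z" "c \<le> 1"
    and hit: "\<And>Y. Y \<subseteq> Z \<Longrightarrow> Y \<noteq> {} \<Longrightarrow> \<exists>i\<in>I. c * card Y \<le> card (Y \<inter> U i)"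
  shows "\<exists>is. set is \<subseteq> I \<and> length is \<le> t \<and>
           card (Z - (\<Union>i\<in>set is. U i)) \<le> (1 - c) ^ t * card Z"
proof (induction t)
  case 0
  show ?case by (rule exI[of _ "[]"]) simp
next
  case (Suc t)
  then obtain "is" where is_props: "set is \<subseteq> I" "length is \<le> t"
    and IH: "card (Z - (\<Union>i\<in>set is. U i)) \<le> (1 - c) ^ t * card Z"
    by blast
  define Y where "Y = Z - (\<Union>i\<in>set is. U i)"
  show ?case
  proof (cases "Y = {}")
    case True
    with is_props \<open>c \<le> 1\<close> show ?thesis
      by (intro exI[of _ "is"]) (auto simp flip: Y_def)
  next
    case False
    then obtain i where i: "i \<in> I" "c * card Y \<le> card (Y \<inter> U i)"
      using hit[of Y] by (auto simp: Y_def)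
    have "finite Y" using \<open>finite Z\<close> by (simp add: Y_def)
    have "Z - (\<Union>i\<in>set (i # is). U i) = Y - Y \<inter> U i"
      by (auto simp: Y_def)
    moreover have "card (Y - Y \<inter> U i) = card Y - card (Y \<inter> U i)" "card (Y \<inter> U i) \<le> card Y"
      using \<open>finite Y\<close> by (simp_all add: card_Diff_subset card_mono)
    ultimately have "real (card (Z - (\<Union>i\<in>set (i # is). U i))) \<le> (1 - c) * card Y"
      using i by (simp add: of_nat_diff algebra_simps)
    also have "\<dots> \<le> (1 - c) ^ Suc t * card Z"
      using IH \<open>c \<le> 1\<close> by (simp add: Y_def mult_left_mono mult.assoc)
    finally show ?thesis
      using is_props i by (intro exI[of _ "i # is"]) auto
  qed
qed

text \<open>The reciprocal \<open>1 + 1 / (q - 1)\<close> has \<open>q\<close>-th power at least 2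
  by Bernoulli. So \<open>q\<close> greedy choices, each hitting a fraction \<open>1 / q\<close>,
  halve the uncovered set.\<close>

lemma one_minus_inverse_power_le_half:
  assumes "q \<ge> 1"
  shows "(1 - 1 / real q) ^ q \<le> 1 / 2"
proof (cases "q = 1")
  case False
  with assms have q: "real q > 1" by simp
  have "1 + real q * (1 / (real q - 1)) \<le> (1 + 1 / (real q - 1)) ^ q"
    using q by (intro Bernoulli_inequality) (simp add: order_trans[of _ 0])
  moreover have "real q * (1 / (real q - 1)) \<ge> 1"
    using q by (simp add: field_simps)
  ultimately have "2 \<le> (1 + 1 / (real q - 1)) ^ q" by linarith
  moreover have "1 - 1 / real q = inverse (1 + 1 / (real q - 1))"
    using q by (simp add: field_simps)
  then have "(1 - 1 / real q) ^ q = inverse ((1 + 1 / (real q - 1)) ^ q)"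
    by (simp only: power_inverse)
  ultimately show ?thesis
    using le_imp_inverse_le[of 2 "(1 + 1 / (real q - 1)) ^ q"] by simp
qed simp

text \<open>The votes are chosen one at a time; a point has weight 4 to the number of wrong votes
  on it so far, and the next vote keeps the increase of the total weight small.\<close>

lemma weighted_votes:
  fixes \<delta> :: real
  assumes "finite Y" "finite H" "H \<noteq> {}"
    and few: "\<forall>z\<in>Y. card {h \<in> H. wrong h z} \<le> \<delta> * card H"
  shows "\<exists>hs. set hs \<subseteq> H \<and> length hs = r \<and>
           (\<Sum>z\<in>Y. 4 ^ length (filter (\<lambda>h. wrong h z) hs)) \<le> (1 + 3 * \<delta>) ^ r * card Y"
proof (cases "Y = {}")
  case True
  from \<open>H \<noteq> {}\<close> obtain h where "h \<in> H" by blast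
  with True show ?thesis by (intro exI[of _ "replicate r h"]) auto
next
  case False
  have "card H > 0" using assms by (simp add: card_gt_0_iff)
  have "\<delta> \<ge> 0"
  proof -
    from False obtain z where "z \<in> Y" by blast
    have "0 \<le> \<delta> * card H" using few \<open>z \<in> Y\<close> of_nat_0_le_iff order_trans by blast
    then show ?thesis using \<open>card H > 0\<close> by (simp add: zero_le_mult_iff)
  qed
  show ?thesis
  proof (induction r)
    case 0
    show ?case by (rule exI[of _ "[]"]) simp
  next
    case (Suc r)
    then obtain hs where hs: "set hs \<subseteq> H" "length hs = r"
      and IH: "(\<Sum>z\<in>Y. 4 ^ length (filter (\<lambda>h. wrong h z) hs)) \<le> (1 + 3 * \<delta>) ^ r * card Y"
      by blast
    define w where "w z = (4 :: real) ^ length (filter (\<lambda>h. wrong h z) hs)" for z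
    \<comment> \<open>Averaging: were every \<open>h\<close> too heavy, summing over
      \<open>H\<close> and exchanging the sums would contradict \<open>few\<close>.\<close>
    have "\<exists>h\<in>H. (\<Sum>z\<in>Y. w z * of_bool (wrong h z)) \<le> \<delta> * (\<Sum>z\<in>Y. w z)"
    proof (rule ccontr)
      assume "\<not> ?thesis"
      then have "(\<Sum>h\<in>H. \<delta> * (\<Sum>z\<in>Y. w z)) < (\<Sum>h\<in>H. \<Sum>z\<in>Y. w z * of_bool (wrong h z))"
        using assms by (intro sum_strict_mono) auto
      also have "\<dots> = (\<Sum>z\<in>Y. w z * (\<Sum>h\<in>H. of_bool (wrong h z)))"
        by (subst sum.swap) (simp add: sum_distrib_left)
      also have "\<dots> = (\<Sum>z\<in>Y. w z * card {h \<in> H. wrong h z})"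
        using \<open>finite H\<close> by (simp add: sum_of_bool_eq Int_def)
      also have "\<dots> \<le> (\<Sum>z\<in>Y. w z * (\<delta> * card H))"
        using few by (intro sum_mono mult_left_mono) (auto simp: w_def)
      finally show False
        by (simp add: sum_distrib_left sum_distrib_right mult_ac)
    qed
    then obtain h where h: "h \<in> H" "(\<Sum>z\<in>Y. w z * of_bool (wrong h z)) \<le> \<delta> * (\<Sum>z\<in>Y. w z)"
      by blast
    \<comment> \<open>A wrong vote multiplies the weight by 4, that is, adds three times the old
      weight.\<close>
    have "(\<Sum>z\<in>Y. 4 ^ length (filter (\<lambda>h. wrong h z) (h # hs))) =
        (\<Sum>z\<in>Y. w z + 3 * (w z * of_bool (wrong h z)))"
      by (intro sum.cong) (auto simp: w_def)
    also have "\<dots> = (\<Sum>z\<in>Y. w z) + 3 * (\<Sum>z\<in>Y. w z * of_bool (wrong h z))"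
      by (simp add: sum.distrib sum_distrib_left)
    also have "\<dots> \<le> (1 + 3 * \<delta>) * (\<Sum>z\<in>Y. w z)"
      using h by (simp add: algebra_simps)
    also have "\<dots> \<le> (1 + 3 * \<delta>) * ((1 + 3 * \<delta>) ^ r * card Y)"
      using IH \<open>\<delta> \<ge> 0\<close> by (intro mult_left_mono) (auto simp: w_def)
    finally show ?case
      using hs h by (intro exI[of _ "h # hs"]) (simp add: mult.assoc)
  qed
qed

text \<open>An error rate of \<open>1 / 12\<close> lets the total weight grow by
  \<open>5 / 4\<close> per vote. A point with at least half of its votes wrong has weight at least
  \<open>2 ^ r\<close>, which would force \<open>(8 / 5) ^ r \<le> 2 ^ N\<close>; but
  \<open>r \<ge> 2 * N\<close> and \<open>(8 / 5) ^ 2 > 2\<close>.\<close>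

lemma majority_votes:
  assumes "finite Y" "card Y \<le> 2 ^ N" "N \<ge> 1" "2 * N \<le> r" "finite H" "H \<noteq> {}"
    and few: "\<And>z. z \<in> Y \<Longrightarrow> 12 * card {h \<in> H. wrong h z} \<le> card H"
  shows "\<exists>hs. set hs \<subseteq> H \<and> length hs = r \<and>
           (\<forall>z\<in>Y. 2 * length (filter (\<lambda>h. wrong h z) hs) < r)"
proof -
  have "\<forall>z\<in>Y. card {h \<in> H. wrong h z} \<le> (1 / 12 :: real) * card H"
  proof
    fix z assume "z \<in> Y"
    from few[OF this] show "card {h \<in> H. wrong h z} \<le> (1 / 12 :: real) * card H"
      by linarith
  qed
  from weighted_votes[OF \<open>finite Y\<close> \<open>finite H\<close> \<open>H \<noteq> {}\<close> this, of r]
  obtain hs where hs: "set hs \<subseteq> H" "length hs = r"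
    and le: "(\<Sum>z\<in>Y. 4 ^ length (filter (\<lambda>h. wrong h z) hs)) \<le> (5 / 4 :: real) ^ r * card Y"
    by auto
  have "2 * length (filter (\<lambda>h. wrong h z) hs) < r" if "z \<in> Y" for z
  proof (rule ccontr)
    let ?l = "length (filter (\<lambda>h. wrong h z) hs)"
    assume "\<not> 2 * ?l < r"
    then have "(2 :: real) ^ r \<le> 2 ^ (2 * ?l)" by (intro power_increasing) auto
    also have "\<dots> = 4 ^ ?l" by (simp add: power_mult)
    also have "\<dots> \<le> (\<Sum>z\<in>Y. 4 ^ length (filter (\<lambda>h. wrong h z) hs))"
      using \<open>finite Y\<close> that by (intro member_le_sum) auto
    also note le
    also have "(5 / 4 :: real) ^ r * card Y \<le> (5 / 4) ^ r * 2 ^ N"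
      using of_nat_mono[OF \<open>card Y \<le> 2 ^ N\<close>, where 'a = real] by (intro mult_left_mono) simp_all
    finally have "(8 / 5 * (5 / 4)) ^ r \<le> (5 / 4 :: real) ^ r * 2 ^ N" by simp
    then have "(8 / 5 :: real) ^ r \<le> 2 ^ N"
      unfolding power_mult_distrib by (simp add: mult.commute)
    moreover have "((8 / 5) ^ 2) ^ N \<le> (8 / 5 :: real) ^ r"
      unfolding power_mult[symmetric] using \<open>2 * N \<le> r\<close> by (intro power_increasing) auto
    moreover have "2 ^ N < ((8 / 5) ^ 2 :: real) ^ N"
      using \<open>N \<ge> 1\<close> by (intro power_strict_mono) (auto simp: power2_eq_square)
    ultimately show False by linarith
  qed
  with hs show ?thesis by blast
qed


lemma length_filter_mono:
  "(\<And>x. x \<in> set xs \<Longrightarrow> P x \<Longrightarrow> Q x) \<Longrightarrow> length (filter P xs) \<le> length (filter Q xs)"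
  by (induction xs) (auto intro: le_SucI)


section \<open>Gadgets built from approximate connectives\<close>

text \<open>The gadgets below are claimed to be exact only at these points; the length of the list
  is the cost that \<open>rho\<close> counts.\<close>

definition uncovered :: "nat \<Rightarrow> model \<Rightarrow> boolfun conn list \<Rightarrow> boolfun" where
  "uncovered n M cs = {z \<in> cube n. \<forall>c \<in> set cs. z \<notin> error_set n M c}"

lemma uncovered_append [simp]:
  "z \<in> uncovered n M (cs @ ds) \<longleftrightarrow> z \<in> uncovered n M cs \<and> z \<in> uncovered n M ds"
  by (auto simp: uncovered_def)

lemma uncovered_Cons:
  "z \<in> uncovered n M (c # cs) \<longleftrightarrow> z \<in> uncovered n M [c] \<and> z \<in> uncovered n M cs"
  by (auto simp: uncovered_def)

lemma uncovered_concat: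
  "z \<in> uncovered n M (concat css) \<longleftrightarrow> z \<in> cube n \<and> (\<forall>cs \<in> set css. z \<in> uncovered n M cs)"
  by (auto simp: uncovered_def)

lemma uncovered_mconj:
  "z \<in> uncovered n M [Conj f g] \<Longrightarrow> z \<in> mconj M f g \<longleftrightarrow> z \<in> f \<and> z \<in> g"
  by (auto simp: uncovered_def error_set_def)

lemma uncovered_mdisj:
  "z \<in> uncovered n M [Disj f g] \<Longrightarrow> z \<in> mdisj M f g \<longleftrightarrow> z \<in> f \<or> z \<in> g"
  by (auto simp: uncovered_def error_set_def)

definition mux :: "model \<Rightarrow> boolfun \<Rightarrow> boolfun \<Rightarrow> boolfun \<Rightarrow> boolfun" where
  "mux M f p q = mdisj M (mconj M f p) (mconj M (mneg M f) q)"

text \<open>Negation is exact, so only the other three connectives are charged.\<close>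

definition mux_errors :: "model \<Rightarrow> boolfun \<Rightarrow> boolfun \<Rightarrow> boolfun \<Rightarrow> boolfun conn list" where
  "mux_errors M f p q =
     [Conj f p, Conj (mneg M f) q, Disj (mconj M f p) (mconj M (mneg M f) q)]"

text \<open>\<open>G\<close> need not consist of all members: in the projective cases it is
  generated by few functions, so that it separates few classes of points.\<close>

locale submodel =
  fixes n :: nat and M :: model and G :: "boolfun set"
  assumes const_in [intro, simp]: "const n b \<in> G"
    and mneg_in [intro, simp]: "f \<in> G \<Longrightarrow> mneg M f \<in> G"
    and mconj_in [intro, simp]: "f \<in> G \<Longrightarrow> g \<in> G \<Longrightarrow> mconj M f g \<in> G"
    and mdisj_in [intro, simp]: "f \<in> G \<Longrightarrow> g \<in> G \<Longrightarrow> mdisj M f g \<in> G"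
    and mneg_exact: "f \<in> G \<Longrightarrow> mneg M f = cube n - f"
begin

definition tests :: "boolfun conn list \<Rightarrow> bool" where
  "tests cs \<longleftrightarrow> (\<forall>c \<in> set cs. set_conn c \<subseteq> G)"

lemma tests_simps [simp]:
  "tests []"
  "tests (c # cs) \<longleftrightarrow> set_conn c \<subseteq> G \<and> tests cs"
  "tests (cs @ ds) \<longleftrightarrow> tests cs \<and> tests ds"
  "tests (concat css) \<longleftrightarrow> (\<forall>cs \<in> set css. tests cs)"
  by (auto simp: tests_def)

lemma mux_in [intro, simp]: "f \<in> G \<Longrightarrow> p \<in> G \<Longrightarrow> q \<in> G \<Longrightarrow> mux M f p q \<in> G"
  by (simp add: mux_def)

lemma tests_mux_errors: "f \<in> G \<Longrightarrow> p \<in> G \<Longrightarrow> q \<in> G \<Longrightarrow> tests (mux_errors M f p q)"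
  by (simp add: mux_errors_def)

lemma mem_mux:
  assumes "z \<in> uncovered n M (mux_errors M f p q)" "f \<in> G"
  shows "z \<in> mux M f p q \<longleftrightarrow> (if z \<in> f then z \<in> p else z \<in> q)"
proof -
  have "z \<in> cube n" using assms by (simp add: uncovered_def)
  moreover have "z \<in> uncovered n M [Conj f p]" "z \<in> uncovered n M [Conj (mneg M f) q]"
    "z \<in> uncovered n M [Disj (mconj M f p) (mconj M (mneg M f) q)]"
    using assms(1) unfolding mux_errors_def by (auto simp: uncovered_def)
  ultimately show ?thesis
    unfolding mux_def by (auto simp: uncovered_mconj uncovered_mdisj mneg_exact[OF \<open>f \<in> G\<close>])
qed

section \<open>Exclusive or, binary addition and majority\<close>

definition xor :: "boolfun \<Rightarrow> boolfun \<Rightarrow> boolfun" where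
  "xor f g = mux M f (mneg M g) g"

definition xor_errors :: "boolfun \<Rightarrow> boolfun \<Rightarrow> boolfun conn list" where
  "xor_errors f g = mux_errors M f (mneg M g) g"

lemma length_xor_errors [simp]: "length (xor_errors f g) = 3"
  by (simp add: xor_errors_def mux_errors_def)

lemma xor_in [intro, simp]: "f \<in> G \<Longrightarrow> g \<in> G \<Longrightarrow> xor f g \<in> G"
  by (simp add: xor_def)

lemma tests_xor_errors [intro, simp]: "f \<in> G \<Longrightarrow> g \<in> G \<Longrightarrow> tests (xor_errors f g)"
  by (simp add: xor_errors_def tests_mux_errors)

lemma mem_xor:
  assumes "z \<in> uncovered n M (xor_errors f g)" "f \<in> G" "g \<in> G"
  shows "z \<in> xor f g \<longleftrightarrow> (z \<in> f) \<noteq> (z \<in> g)"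
proof -
  have "z \<in> cube n" using assms(1) by (simp add: uncovered_def)
  then show ?thesis
    using mem_mux[OF assms(1)[unfolded xor_errors_def] \<open>f \<in> G\<close>] mneg_exact[OF \<open>g \<in> G\<close>]
    by (auto simp: xor_def)
qed

text \<open>The sum bit is a double exclusive or; the carry is \<open>c\<close> where
  \<open>a\<close> and \<open>b\<close> differ and \<open>a\<close> elsewhere, which is a
  multiplexer. Three gadgets of three tests each make 9.\<close>

lemma full_adder_ex:
  assumes "a \<in> G" "b \<in> G" "c \<in> G"
  shows "\<exists>s\<in>G. \<exists>d\<in>G. \<exists>cs. tests cs \<and> length cs = 9 \<and>
           (\<forall>z\<in>uncovered n M cs. of_bool (z \<in> s) + 2 * of_bool (z \<in> d) =
              (of_bool (z \<in> a) + of_bool (z \<in> b) + of_bool (z \<in> c) :: nat))"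
proof -
  define x where "x = xor a b"
  define cs where "cs = xor_errors a b @ xor_errors x c @ mux_errors M x c a"
  have "x \<in> G" using assms by (simp add: x_def)
  have "of_bool (z \<in> xor x c) + 2 * of_bool (z \<in> mux M x c a) =
      (of_bool (z \<in> a) + of_bool (z \<in> b) + of_bool (z \<in> c) :: nat)"
    if "z \<in> uncovered n M cs" for z
    using that mem_xor[of z a b] mem_xor[of z x c] mem_mux[of z x c a] assms \<open>x \<in> G\<close>
    by (simp add: cs_def flip: x_def)
  then show ?thesis
    using assms \<open>x \<in> G\<close> tests_mux_errors
    by (intro bexI[of _ "xor x c"] bexI[of _ "mux M x c a"] exI[of _ cs])
       (simp_all add: cs_def mux_errors_def)
qed

definition num :: "boolfun list \<Rightarrow> bool list \<Rightarrow> nat" where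
  "num us z = horner_sum (\<lambda>u. of_bool (z \<in> u)) 2 us"

lemma num_simps [simp]: "num [] z = 0" "num (u # us) z = of_bool (z \<in> u) + 2 * num us z"
  by (simp_all add: num_def)

text \<open>Ripple-carry addition from the least significant digit: \<open>c\<close> is the incoming
  carry, and the last outgoing carry becomes the extra top digit.\<close>

lemma adder_ex:
  assumes "set us \<subseteq> G" "set vs \<subseteq> G" "length us = length vs" "c \<in> G"
  shows "\<exists>ws cs. set ws \<subseteq> G \<and> length ws = Suc (length us) \<and> tests cs \<and>
           length cs = 9 * length us \<and>
           (\<forall>z\<in>uncovered n M cs. num ws z = num us z + num vs z + of_bool (z \<in> c))"
  using assms(3,1,2,4)
proof (induction us vs arbitrary: c rule: list_induct2)
  case Nil
  then show ?case by (intro exI[of _ "[c]"] exI[of _ "[]"]) simp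
next
  case (Cons u us v vs)
  then obtain s d cs where s: "s \<in> G" "d \<in> G" "tests cs" "length cs = 9"
    "\<And>z. z \<in> uncovered n M cs \<Longrightarrow> of_bool (z \<in> s) + 2 * of_bool (z \<in> d) =
              (of_bool (z \<in> u) + of_bool (z \<in> v) + of_bool (z \<in> c) :: nat)"
    using full_adder_ex[of u v c] by auto
  from Cons s(2) obtain ws ds where ws: "set ws \<subseteq> G" "length ws = Suc (length us)" "tests ds"
    "length ds = 9 * length us"
    "\<And>z. z \<in> uncovered n M ds \<Longrightarrow> num ws z = num us z + num vs z + of_bool (z \<in> d)"
    by (metis (no_types, lifting) list.set_intros(2) subset_iff)
  have "num (s # ws) z = num (u # us) z + num (v # vs) z + of_bool (z \<in> c)"
    if "z \<in> uncovered n M (cs @ ds)" for z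
    using s(5)[of z] ws(5)[of z] that by simp
  then show ?case
    using s ws by (intro exI[of _ "s # ws"] exI[of _ "cs @ ds"]) simp
qed

text \<open>Count both halves recursively and add. The cost satisfies T(0) = 0 and T(k+1) = 2 T(k) +
  9 (k+1), whose solution \<open>18 * 2 ^ k - 9 * k - 18\<close> dictates the form of the bound; the
  total is linear in the number of summands.\<close>

lemma counter_ex:
  assumes "set xs \<subseteq> G" "length xs = 2 ^ k"
  shows "\<exists>ws cs. set ws \<subseteq> G \<and> length ws = Suc k \<and> tests cs \<and>
           length cs + 9 * k + 18 \<le> 18 * 2 ^ k \<and>
           (\<forall>z\<in>uncovered n M cs. num ws z = length (filter (\<lambda>x. z \<in> x) xs))"
  using assms
proof (induction k arbitrary: xs)
  case 0
  then obtain x where "xs = [x]" by (auto simp: length_Suc_conv)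
  with 0 show ?case by (intro exI[of _ "[x]"] exI[of _ "[]"]) simp
next
  case (Suc k)
  define ys zs where "ys = take (2 ^ k) xs" and "zs = drop (2 ^ k) xs"
  have xs: "xs = ys @ zs" "length ys = 2 ^ k" "length zs = 2 ^ k" "set ys \<subseteq> G" "set zs \<subseteq> G"
    using Suc.prems set_take_subset[of "2 ^ k" xs] set_drop_subset[of "2 ^ k" xs]
    by (auto simp: ys_def zs_def)
  obtain us cs where us: "set us \<subseteq> G" "length us = Suc k" "tests cs"
    "length cs + 9 * k + 18 \<le> 18 * 2 ^ k"
    "\<And>z. z \<in> uncovered n M cs \<Longrightarrow> num us z = length (filter (\<lambda>x. z \<in> x) ys)"
    using Suc.IH[OF xs(4,2)] by blast
  obtain vs ds where vs: "set vs \<subseteq> G" "length vs = Suc k" "tests ds"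
    "length ds + 9 * k + 18 \<le> 18 * 2 ^ k"
    "\<And>z. z \<in> uncovered n M ds \<Longrightarrow> num vs z = length (filter (\<lambda>x. z \<in> x) zs)"
    using Suc.IH[OF xs(5,3)] by blast
  obtain ws es where ws: "set ws \<subseteq> G" "length ws = Suc (length us)" "tests es"
    "length es = 9 * length us"
    "\<And>z. z \<in> uncovered n M es \<Longrightarrow> num ws z = num us z + num vs z + of_bool (z \<in> const n False)"
    using adder_ex[OF us(1) vs(1), of "const n False"] us(2) vs(2) by auto
  have "num ws z = length (filter (\<lambda>x. z \<in> x) xs)" if "z \<in> uncovered n M (cs @ ds @ es)" for z
    using us(5)[of z] vs(5)[of z] ws(5)[of z] that by (simp add: xs(1) const_def)
  then show ?case
    using us vs ws
    by (intro exI[of _ ws] exI[of _ "cs @ ds @ es"]) simp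
qed

lemma num_top_bits: "length us = k \<Longrightarrow> num (us @ [a, b]) z = num us z + 2 ^ k * (of_bool (z \<in> a) + 2 * of_bool (z \<in> b))"
  by (induction us arbitrary: k) (auto simp: algebra_simps)

lemma num_less: "num us z < 2 ^ length us"
  by (induction us) (auto simp: of_bool_def)

text \<open>The length is a power of two, so the count has \<open>k + 2\<close> digits and reaches
  half, \<open>2 ^ k\<close>, exactly when one of its two top digits is set. One disjunction thus
  replaces a comparison; a tie counts as a yes.\<close>

lemma majority_ex:
  assumes "set xs \<subseteq> G" "length xs = 2 ^ Suc k"
  shows "\<exists>g\<in>G. \<exists>cs. tests cs \<and> length cs \<le> 18 * length xs \<and>
           (\<forall>z\<in>uncovered n M cs. z \<in> g \<longleftrightarrow> length xs \<le> 2 * length (filter (\<lambda>x. z \<in> x) xs))"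
proof -
  obtain ws cs where ws: "set ws \<subseteq> G" "length ws = Suc (Suc k)" "tests cs"
    "length cs + 9 * Suc k + 18 \<le> 18 * 2 ^ Suc k"
    "\<And>z. z \<in> uncovered n M cs \<Longrightarrow> num ws z = length (filter (\<lambda>x. z \<in> x) xs)"
    using counter_ex[OF assms] by blast
  obtain vs b where vs: "ws = vs @ [b]" "length vs = Suc k"
    using ws(2) by (cases ws rule: rev_cases) auto
  then obtain us a where us: "ws = us @ [a, b]" "length us = k"
    by (cases vs rule: rev_cases) auto
  have "z \<in> mdisj M a b \<longleftrightarrow> length xs \<le> 2 * length (filter (\<lambda>x. z \<in> x) xs)"
    if z: "z \<in> uncovered n M (Disj a b # cs)" for z
  proof -
    have "z \<in> uncovered n M cs" "z \<in> mdisj M a b \<longleftrightarrow> z \<in> a \<or> z \<in> b"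
      using z uncovered_mdisj uncovered_Cons by blast+
    then show ?thesis
      using ws(5)[of z] num_less[of us z] assms(2) us by (auto simp: num_top_bits)
  qed
  then show ?thesis
    using ws us assms(2) by (intro bexI[of _ "mdisj M a b"] exI[of _ "Disj a b # cs"]) auto
qed


section \<open>Approximating one oracle gate\<close>

text \<open>A full decision tree of multiplexers. Its exponential size is harmless, because only the
  errors of selected nodes will be charged.\<close>

fun tree :: "boolfun list \<Rightarrow> boolfun \<Rightarrow> boolfun" where
  "tree [] h = const n ([] \<in> h)"
| "tree (f # fs) h = mux M f (tree fs {a. True # a \<in> h}) (tree fs {a. False # a \<in> h})"

definition node :: "boolfun \<Rightarrow> boolfun list \<Rightarrow> boolfun \<Rightarrow> boolfun conn list" where
  "node f fs h = mux_errors M f (tree fs {a. True # a \<in> h}) (tree fs {a. False # a \<in> h})"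

text \<open>An inner node is the root of the tree of a cofactor, so a level is indexed by all
  functions of the remaining arguments and is shared by all trees.\<close>

fun nodes :: "boolfun list \<Rightarrow> boolfun conn list set" where
  "nodes [] = {}"
| "nodes (f # fs) = nodes fs \<union> node f fs ` boolfuns (Suc (length fs))"

definition wrong :: "boolfun list \<Rightarrow> boolfun \<Rightarrow> bool list \<Rightarrow> bool" where
  "wrong fs h z \<longleftrightarrow> (z \<in> tree fs h) \<noteq> (map (\<lambda>f. z \<in> f) fs \<in> h)"

lemma tree_in: "set fs \<subseteq> G \<Longrightarrow> tree fs h \<in> G"
  by (induction fs arbitrary: h) auto

lemma nodesD: "set fs \<subseteq> G \<Longrightarrow> cs \<in> nodes fs \<Longrightarrow> tests cs \<and> length cs = 3"
  by (induction fs) (auto simp: node_def tree_in tests_mux_errors, auto simp: mux_errors_def)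

lemma wrong_Nil: "z \<in> cube n \<Longrightarrow> \<not> wrong [] h z"
  by (simp add: wrong_def const_def)

text \<open>An exact multiplexer forwards the selected subtree, so an error arises at the root or
  comes from the subtree that \<open>z\<close> selects.\<close>

lemma wrong_Cons:
  assumes "wrong (f # fs) h z" "f \<in> G"
  shows "wrong fs {a. (z \<in> f) # a \<in> h} z \<or> z \<notin> uncovered n M (node f fs h)"
  using assms mem_mux[of z f "tree fs {a. True # a \<in> h}" "tree fs {a. False # a \<in> h}"]
  by (cases "z \<in> f") (auto simp: wrong_def node_def)

text \<open>The cofactors of a uniformly random function are uniformly random, so the probability
  of an error at a point grows along the path of that point only by the density of one
  random node per level.\<close>

lemma sum_wrong_le:
  fixes c :: real
  assumes "set fs \<subseteq> G" "finite Y" "Y \<subseteq> cube n"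
    and sparse: "\<And>cs. cs \<in> nodes fs \<Longrightarrow> card (Y - uncovered n M cs) \<le> c * card Y"
  shows "(\<Sum>z\<in>Y. card {h \<in> boolfuns (length fs). wrong fs h z})
           \<le> length fs * c * card Y * card (boolfuns (length fs))"
  using assms(1) sparse
proof (induction fs)
  case Nil
  then show ?case using \<open>Y \<subseteq> cube n\<close> by (simp add: wrong_Nil subset_iff)
next
  case (Cons f fs)
  let ?F = "boolfuns (length fs)" and ?F' = "boolfuns (Suc (length fs))"
  have cF: "card ?F' = card ?F * card ?F"
    by (simp add: card_boolfuns flip: power_add mult_2)
  have "f \<in> G" using Cons.prems by simp
  \<comment> \<open>Union bound over the two sources of an error; the factor \<open>card ?F\<close>
    counts the free choices of the other cofactor.\<close>
  have step: "card {h \<in> ?F'. wrong (f # fs) h z} \<le>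
      card {h \<in> ?F. wrong fs h z} * card ?F + card {h \<in> ?F'. z \<notin> uncovered n M (node f fs h)}" for z
  proof -
    have "{h \<in> ?F'. wrong (f # fs) h z} \<subseteq>
        {h \<in> ?F'. wrong fs {a. (z \<in> f) # a \<in> h} z} \<union> {h \<in> ?F'. z \<notin> uncovered n M (node f fs h)}"
      using wrong_Cons[OF _ \<open>f \<in> G\<close>] by auto
    then have "card {h \<in> ?F'. wrong (f # fs) h z} \<le>
        card ({h \<in> ?F'. wrong fs {a. (z \<in> f) # a \<in> h} z} \<union> {h \<in> ?F'. z \<notin> uncovered n M (node f fs h)})"
      by (intro card_mono) (simp_all add: finite_boolfuns)
    also have "\<dots> \<le> card {h \<in> ?F'. wrong fs {a. (z \<in> f) # a \<in> h} z} +
        card {h \<in> ?F'. z \<notin> uncovered n M (node f fs h)}"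
      by (rule card_Un_le)
    finally show ?thesis
      by (simp only: card_boolfuns_cofactor[where P = "\<lambda>p. wrong fs p z"])
  qed
  \<comment> \<open>Double counting of pairs of a point and a root node failing there: by sparsity
    each node fails at no more than \<open>c * card Y\<close> points.\<close>
  have "(\<Sum>z\<in>Y. card {h \<in> ?F'. z \<notin> uncovered n M (node f fs h)}) =
      (\<Sum>h\<in>?F'. card {z \<in> Y. z \<notin> uncovered n M (node f fs h)})"
    using sum.swap[of "\<lambda>z h. of_bool (z \<notin> uncovered n M (node f fs h)) :: nat" ?F' Y]
    by (simp add: \<open>finite Y\<close> finite_boolfuns sum_of_bool_eq Int_def)
  also have "real \<dots> \<le> (\<Sum>h\<in>?F'. c * card Y)"
    unfolding of_nat_sum using Cons.prems(2) by (intro sum_mono) (auto simp: set_diff_eq)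
  finally have errs: "real (\<Sum>z\<in>Y. card {h \<in> ?F'. z \<notin> uncovered n M (node f fs h)})
      \<le> card ?F' * (c * card Y)"
    by simp
  have IH: "real (\<Sum>z\<in>Y. card {h \<in> ?F. wrong fs h z}) \<le> length fs * c * card Y * card ?F"
    using Cons by simp
  have "(\<Sum>z\<in>Y. card {h \<in> ?F'. wrong (f # fs) h z}) \<le>
      (\<Sum>z\<in>Y. card {h \<in> ?F. wrong fs h z}) * card ?F +
      (\<Sum>z\<in>Y. card {h \<in> ?F'. z \<notin> uncovered n M (node f fs h)})"
    unfolding sum_distrib_right sum.distrib[symmetric] by (intro sum_mono step)
  then have "real (\<Sum>z\<in>Y. card {h \<in> ?F'. wrong (f # fs) h z}) \<le>
      real (\<Sum>z\<in>Y. card {h \<in> ?F. wrong fs h z}) * card ?F +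
      real (\<Sum>z\<in>Y. card {h \<in> ?F'. z \<notin> uncovered n M (node f fs h)})"
    by (simp only: flip: of_nat_add of_nat_mult)
  also have "\<dots> \<le> (length fs * c * card Y * card ?F) * card ?F + card ?F' * (c * card Y)"
    using IH errs by (intro add_mono mult_right_mono) auto
  finally show ?case by (simp add: cF algebra_simps)
qed

text \<open>If no node failed on a fraction \<open>1 / q\<close> of a nonempty set of bad points,
  \<open>sum_wrong_le\<close> would bound the average error rate there by
  \<open>length fs / q = 1 / 24\<close>, while every bad point exceeds that rate. So the greedy
  cover applies to the bad points.\<close>

lemma cover_wrong_ex:
  assumes "set fs \<subseteq> G" "fs \<noteq> []" "finite Z" "Z \<subseteq> cube n" "card Z \<le> 2 ^ N"
  shows "\<exists>cs. tests cs \<and> length cs \<le> 72 * length fs * (N + 1) \<and>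
           (\<forall>z\<in>Z \<inter> uncovered n M cs.
              24 * card {h \<in> boolfuns (length fs). wrong fs h z} \<le> card (boolfuns (length fs)))"
proof -
  let ?F = "boolfuns (length fs)"
  \<comment> \<open>\<open>N + 1\<close> halvings bring at most \<open>2 ^ N\<close> points below
    one, and each halving takes \<open>q\<close> nodes. With three tests per node this gives the
    constant 72.\<close>
  define q t where "q = 24 * length fs" and "t = q * (N + 1)"
  define Z' where "Z' = {z \<in> Z. card ?F < 24 * card {h \<in> ?F. wrong fs h z}}"
  have "q \<ge> 1" using \<open>fs \<noteq> []\<close> by (simp add: q_def Suc_leI)
  have Z': "finite Z'" "Z' \<subseteq> cube n" "card Z' \<le> 2 ^ N"
    using assms card_mono[of Z Z'] by (auto simp: Z'_def)
  have "\<exists>cs\<in>nodes fs. 1 / real q * card Y \<le> card (Y \<inter> - uncovered n M cs)"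
    if "Y \<subseteq> Z'" "Y \<noteq> {}" for Y
  proof (rule ccontr)
    assume "\<not> ?thesis"
    then have sparse: "card (Y - uncovered n M cs) \<le> 1 / real q * card Y" if "cs \<in> nodes fs" for cs
      using that by (auto simp: Diff_eq not_le intro: less_imp_le)
    have "finite Y" using that Z' finite_subset by blast
    have "(\<Sum>z\<in>Y. card ?F) < (\<Sum>z\<in>Y. 24 * card {h \<in> ?F. wrong fs h z})"
      using that \<open>finite Y\<close> by (intro sum_strict_mono) (auto simp: Z'_def)
    then have "card Y * card ?F < 24 * (\<Sum>z\<in>Y. card {h \<in> ?F. wrong fs h z})"
      by (simp add: sum_distrib_left)
    then have "real (card Y * card ?F) < 24 * real (\<Sum>z\<in>Y. card {h \<in> ?F. wrong fs h z})"
      by linarith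
    also have "\<dots> \<le> 24 * (length fs * (1 / real q) * card Y * card ?F)"
      using that \<open>finite Y\<close> Z' sparse assms(1) by (intro mult_left_mono sum_wrong_le) auto
    finally show False using \<open>fs \<noteq> []\<close> by (simp add: q_def)
  qed
  from greedy_cover[OF Z'(1) _ this, of t] \<open>q \<ge> 1\<close>
  obtain css where css: "set css \<subseteq> nodes fs" "length css \<le> t"
    "card (Z' - (\<Union>cs\<in>set css. - uncovered n M cs)) \<le> (1 - 1 / real q) ^ t * card Z'"
    by auto
  have "(1 - 1 / real q) ^ t * card Z' \<le> (1 / 2) ^ (N + 1) * 2 ^ N"
    unfolding t_def power_mult
    using one_minus_inverse_power_le_half[OF \<open>q \<ge> 1\<close>] of_nat_mono[OF Z'(3), where 'a = real] \<open>q \<ge> 1\<close>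
    by (intro mult_mono power_mono) auto
  also have "\<dots> < 1" by (simp add: power_one_over)
  finally have "card (Z' - (\<Union>cs\<in>set css. - uncovered n M cs)) = 0"
    using css(3) by linarith
  then have "Z' \<subseteq> (\<Union>cs\<in>set css. - uncovered n M cs)"
    using Z'(1) by simp
  then have "Z' \<inter> uncovered n M (concat css) = {}"
    by (auto simp: uncovered_concat)
  moreover have "tests (concat css)" using css(1) nodesD[OF assms(1)] by auto
  moreover have "length (concat css) = 3 * length css"
    using css(1) nodesD[OF assms(1)] by (induction css) auto
  ultimately show ?thesis
    using css(2) by (intro exI[of _ "concat css"]) (auto simp: Z'_def t_def q_def not_less)
qed

text \<open>Error sets of tests from \<open>G\<close> are Boolean combinations of elements of
  \<open>G\<close> within the cube, so they cannot separate points that \<open>G\<close> does not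
  separate.\<close>

lemma uncovered_cong:
  assumes "tests cs" "z \<in> uncovered n M cs" "y \<in> cube n" "\<And>u. u \<in> G \<Longrightarrow> z \<in> u \<longleftrightarrow> y \<in> u"
  shows "y \<in> uncovered n M cs"
proof -
  have "y \<notin> error_set n M c" if "c \<in> set cs" for c
  proof -
    have "set_conn c \<subseteq> G" "z \<notin> error_set n M c" "z \<in> cube n"
      using assms that by (auto simp: tests_def uncovered_def)
    with assms(3,4) show ?thesis
      by (cases c) (auto simp: error_set_def)
  qed
  with \<open>y \<in> cube n\<close> show ?thesis by (simp add: uncovered_def)
qed

text \<open>\<open>Z\<close> represents the points up to indistinguishability by \<open>G\<close>.
  Covering and voting are carried out on \<open>Z\<close> only, and \<open>uncovered_cong\<close>
  transfers the result to the whole cube.\<close>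

lemma approximation_ex:
  assumes fs: "set fs \<subseteq> G" "fs \<noteq> []" and "N \<ge> 1"
    and Z: "finite Z" "Z \<subseteq> cube n" "card Z \<le> 2 ^ N"
    and reps: "\<And>z. z \<in> cube n \<Longrightarrow> \<exists>y\<in>Z. \<forall>u\<in>G. z \<in> u \<longleftrightarrow> y \<in> u"
  shows "\<exists>g\<in>G. \<exists>cs. tests cs \<and> length cs \<le> 228 * N * length fs \<and>
           (\<forall>z\<in>uncovered n M cs. z \<in> g \<longleftrightarrow> \<phi> (map (\<lambda>f. z \<in> f) fs))"
proof -
  let ?F = "boolfuns (length fs)"
  define \<Phi> where "\<Phi> = {a \<in> cube (length fs). \<phi> a}"
  \<comment> \<open>The vote of \<open>h\<close> is the exclusive or of the trees of
    \<open>h\<close> and \<open>h \<oplus> \<Phi>\<close>; it can fail only if one of them is wrong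
    or the gadget itself errs, and the latter is charged to \<open>err\<close>.\<close>
  define bad where "bad h z \<longleftrightarrow> wrong fs h z \<or> wrong fs (sym_diff h \<Phi>) z" for h z
  define w where "w h = xor (tree fs h) (tree fs (sym_diff h \<Phi>))" for h
  define err where "err h = xor_errors (tree fs h) (tree fs (sym_diff h \<Phi>))" for h
  obtain cs where cs: "tests cs" "length cs \<le> 72 * length fs * (N + 1)"
    "\<And>z. z \<in> Z \<inter> uncovered n M cs \<Longrightarrow> 24 * card {h \<in> ?F. wrong fs h z} \<le> card ?F"
    using cover_wrong_ex[OF fs Z] by blast
  \<comment> \<open>Adding \<open>\<Phi>\<close> is an involution of the functions, so both trees
    have error rate at most \<open>1 / 24\<close>, together \<open>1 / 12\<close>.\<close>
  have few_bad: "12 * card {h \<in> ?F. bad h z} \<le> card ?F" if "z \<in> Z \<inter> uncovered n M cs" for z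
  proof -
    have "{h \<in> ?F. wrong fs (sym_diff h \<Phi>) z} \<subseteq> (\<lambda>h. sym_diff h \<Phi>) ` {h \<in> ?F. wrong fs h z}"
    proof
      fix h assume "h \<in> {h \<in> ?F. wrong fs (sym_diff h \<Phi>) z}"
      then have "h = sym_diff (sym_diff h \<Phi>) \<Phi>" "sym_diff h \<Phi> \<in> {h \<in> ?F. wrong fs h z}"
        by (auto simp: boolfuns_def \<Phi>_def)
      then show "h \<in> (\<lambda>h. sym_diff h \<Phi>) ` {h \<in> ?F. wrong fs h z}" by (rule image_eqI)
    qed
    then have "card {h \<in> ?F. wrong fs (sym_diff h \<Phi>) z} \<le> card {h \<in> ?F. wrong fs h z}"
      by (intro surj_card_le) (simp_all add: finite_boolfuns)
    moreover have "{h \<in> ?F. bad h z} = {h \<in> ?F. wrong fs h z} \<union> {h \<in> ?F. wrong fs (sym_diff h \<Phi>) z}"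
      by (auto simp: bad_def)
    ultimately show ?thesis
      using cs(3)[OF that] card_Un_le[of "{h \<in> ?F. wrong fs h z}" "{h \<in> ?F. wrong fs (sym_diff h \<Phi>) z}"]
      by simp
  qed
  obtain k where k: "2 ^ k \<le> N" "N < 2 ^ (k + 1)"
    using ex_power_ivl1[of 2 N] \<open>N \<ge> 1\<close> by auto
  \<comment> \<open>A power of two, as the counter demands, between \<open>2 * N\<close>, as the
    vote demands, and \<open>4 * N\<close>, for the cost.\<close>
  define r where "r = (2 :: nat) ^ Suc (Suc k)"
  have r: "2 * N \<le> r" "r \<le> 4 * N" using k by (auto simp: r_def)
  have "finite (Z \<inter> uncovered n M cs)" "card (Z \<inter> uncovered n M cs) \<le> 2 ^ N"
    using Z card_mono[of Z "Z \<inter> uncovered n M cs"] by auto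
  moreover have "finite ?F" "?F \<noteq> {}" by (simp_all add: finite_boolfuns) (auto simp: boolfuns_def)
  ultimately obtain hs where hs: "length hs = r"
    "\<And>z. z \<in> Z \<inter> uncovered n M cs \<Longrightarrow> 2 * length (filter (\<lambda>h. bad h z) hs) < r"
    using majority_votes[of "Z \<inter> uncovered n M cs" N r ?F bad] \<open>N \<ge> 1\<close> r few_bad by blast
  have w_in: "w h \<in> G" "tests (err h)" "length (err h) = 3" for h
    using tree_in[OF fs(1)] by (simp_all add: w_def err_def)
  obtain g ds where g: "g \<in> G" "tests ds" "length ds \<le> 18 * r"
    "\<And>z. z \<in> uncovered n M ds \<Longrightarrow> z \<in> g \<longleftrightarrow> r \<le> 2 * length (filter (\<lambda>x. z \<in> x) (map w hs))"
    using majority_ex[of "map w hs" "Suc k"] hs(1) w_in unfolding r_def by fastforce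
  define es where "es = cs @ concat (map err hs) @ ds"
  have "tests es" using cs g w_in by (simp add: es_def)
  have "length (concat (map err hs)) = 3 * r"
    unfolding hs(1)[symmetric] by (induction hs) (auto simp: w_in)
  \<comment> \<open>The \<open>r\<close> exclusive ors cost \<open>3 * r\<close> and the majority at
    most \<open>18 * r\<close>. As \<open>N + 1 \<le> 2 * N\<close> and
    \<open>r \<le> 4 * N\<close>, the total constant is 144 + 84 = 228.\<close>
  then have "length es \<le> 72 * length fs * (N + 1) + 21 * r"
    using cs(2) g(3) by (simp add: es_def)
  also have "\<dots> \<le> 72 * length fs * (2 * N) + 84 * (N * length fs)"
  proof (rule add_mono)
    have "N * 1 \<le> N * length fs" using fs(2) by (intro mult_le_mono) (auto simp: Suc_leI)
    then show "21 * r \<le> 84 * (N * length fs)" using r(2) by linarith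
  qed (use \<open>N \<ge> 1\<close> in simp)
  finally have length_es: "length es \<le> 228 * N * length fs" by (simp add: algebra_simps)
  have correct: "y \<in> g \<longleftrightarrow> \<phi> (map (\<lambda>f. y \<in> f) fs)" if "y \<in> Z" "y \<in> uncovered n M es" for y
  proof -
    have y: "y \<in> Z \<inter> uncovered n M cs" "y \<in> uncovered n M ds" "\<And>h. h \<in> set hs \<Longrightarrow> y \<in> uncovered n M (err h)"
      using that by (auto simp: es_def uncovered_concat)
    have "map (\<lambda>f. y \<in> f) fs \<in> \<Phi> \<longleftrightarrow> \<phi> (map (\<lambda>f. y \<in> f) fs)"
      by (simp add: \<Phi>_def cube_def)
    then have good: "y \<in> w h \<longleftrightarrow> \<phi> (map (\<lambda>f. y \<in> f) fs)" if "h \<in> set hs" "\<not> bad h y" for h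
      using that mem_xor[OF y(3)[OF that(1), unfolded err_def] tree_in[OF fs(1)] tree_in[OF fs(1)]]
      by (auto simp: bad_def wrong_def w_def)
    have fw: "length (filter (\<lambda>x. y \<in> x) (map w hs)) = length (filter (\<lambda>h. y \<in> w h) hs)"
      by (simp add: filter_map o_def)
    \<comment> \<open>Strictly fewer than half of the votes are bad, so no tie can occur.\<close>
    show ?thesis
    proof (cases "\<phi> (map (\<lambda>f. y \<in> f) fs)")
      case True
      have "length (filter (\<lambda>h. y \<notin> w h) hs) \<le> length (filter (\<lambda>h. bad h y) hs)"
        using good True by (intro length_filter_mono) auto
      with True g(4)[OF y(2)] hs(2)[OF y(1)] sum_length_filter_compl[of "\<lambda>h. y \<in> w h" hs] hs(1) fw
      show ?thesis by linarith
    next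
      case False
      have "length (filter (\<lambda>h. y \<in> w h) hs) \<le> length (filter (\<lambda>h. bad h y) hs)"
        using good False by (intro length_filter_mono) auto
      with False g(4)[OF y(2)] hs(2)[OF y(1)] fw show ?thesis by linarith
    qed
  qed
  have "z \<in> g \<longleftrightarrow> \<phi> (map (\<lambda>f. z \<in> f) fs)" if z: "z \<in> uncovered n M es" for z
  proof -
    obtain y where y: "y \<in> Z" "\<And>u. u \<in> G \<Longrightarrow> z \<in> u \<longleftrightarrow> y \<in> u"
      using reps[of z] z by (auto simp: uncovered_def)
    then have "y \<in> uncovered n M es"
      using uncovered_cong[OF \<open>tests es\<close> z] Z(2) by blast
    moreover have "map (\<lambda>f. z \<in> f) fs = map (\<lambda>f. y \<in> f) fs"
      using fs(1) y(2) by auto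
    ultimately show ?thesis
      using correct y g(1) by metis
  qed
  with g(1) \<open>tests es\<close> length_es show ?thesis by blast
qed


text \<open>By \<open>inv\<close>, a point matters to \<open>G\<close> only through its vector of
  values under \<open>fs\<close>. One representative per vector gives at most
  \<open>2 ^ length fs\<close> points.\<close>

lemma approximation_ex_invariant:
  assumes "set fs \<subseteq> G" "fs \<noteq> []"
    and inv: "\<And>u z y. u \<in> G \<Longrightarrow> z \<in> cube n \<Longrightarrow> y \<in> cube n \<Longrightarrow> \<forall>f\<in>set fs. z \<in> f \<longleftrightarrow> y \<in> f \<Longrightarrow>
                z \<in> u \<longleftrightarrow> y \<in> u"
  shows "\<exists>g\<in>G. \<exists>cs. tests cs \<and> length cs \<le> 228 * length fs * length fs \<and>
           (\<forall>z\<in>uncovered n M cs. z \<in> g \<longleftrightarrow> \<phi> (map (\<lambda>f. z \<in> f) fs))"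
proof -
  define key where "key z = map (\<lambda>f. z \<in> f) fs" for z
  define rep where "rep a = (SOME z. z \<in> cube n \<and> key z = a)" for a
  have rep: "rep (key z) \<in> cube n \<and> key (rep (key z)) = key z" if "z \<in> cube n" for z
    unfolding rep_def by (rule someI[of _ z]) (use that in simp)
  define Z where "Z = rep ` key ` cube n"
  have "key ` cube n \<subseteq> cube (length fs)" by (auto simp: key_def cube_def)
  then have "card (key ` cube n) \<le> 2 ^ length fs"
    using card_mono[OF finite_cube] card_cube by metis
  then have "card Z \<le> 2 ^ length fs"
    unfolding Z_def using card_image_le[of "key ` cube n" rep] finite_cube by fastforce
  moreover have "finite Z" "Z \<subseteq> cube n"
    using rep by (auto simp: Z_def finite_cube)
  moreover have "\<exists>y\<in>Z. \<forall>u\<in>G. z \<in> u \<longleftrightarrow> y \<in> u" if "z \<in> cube n" for z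
  proof -
    have "\<forall>f\<in>set fs. z \<in> f \<longleftrightarrow> rep (key z) \<in> f"
      using rep[OF that] by (auto simp: key_def map_eq_conv)
    then have "\<forall>u\<in>G. z \<in> u \<longleftrightarrow> rep (key z) \<in> u"
      using inv[of _ z "rep (key z)"] rep[OF that] that by blast
    then show ?thesis using that by (auto simp: Z_def)
  qed
  moreover have "length fs \<ge> 1" using \<open>fs \<noteq> []\<close> by (simp add: Suc_leI)
  ultimately show ?thesis using approximation_ex[OF assms(1,2)] by blast
qed

end

section \<open>Functions generated inside a model\<close>

text \<open>The least submodel over \<open>B\<close>. Its elements are the values of approximate
  circuits on \<open>B\<close>, which is what the projectivity conditions speak about.\<close>

inductive_set gen :: "nat \<Rightarrow> model \<Rightarrow> boolfun set \<Rightarrow> boolfun set" for n M B where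
  gen_base: "f \<in> B \<Longrightarrow> f \<in> gen n M B"
| gen_const: "const n b \<in> gen n M B"
| gen_mneg: "f \<in> gen n M B \<Longrightarrow> mneg M f \<in> gen n M B"
| gen_mconj: "f \<in> gen n M B \<Longrightarrow> g \<in> gen n M B \<Longrightarrow> mconj M f g \<in> gen n M B"
| gen_mdisj: "f \<in> gen n M B \<Longrightarrow> g \<in> gen n M B \<Longrightarrow> mdisj M f g \<in> gen n M B"

lemma submodel_members:
  "legitimate n M \<Longrightarrow> exact_neg n M \<Longrightarrow> submodel n M (members M)"
  by unfold_locales (auto simp: legitimate_def exact_neg_def)

lemma gen_subset_members:
  assumes "legitimate n M" "B \<subseteq> members M"
  shows "gen n M B \<subseteq> members M"
proof
  fix u assume "u \<in> gen n M B"
  then show "u \<in> members M"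
    using assms by induction (auto simp: legitimate_def)
qed

lemma submodel_gen:
  "legitimate n M \<Longrightarrow> exact_neg n M \<Longrightarrow> B \<subseteq> members M \<Longrightarrow> submodel n M (gen n M B)"
  using gen_subset_members[of n M B]
  by unfold_locales (auto simp: exact_neg_def intro: gen.intros)

section \<open>Circuits for generated functions\<close>

lemma run_Nil [simp]: "run step [] = []"
  by (simp add: run_def)

lemma run_snoc [simp]: "run step (gs @ [g]) = run step gs @ [step (run step gs) g]"
  by (simp add: run_def)

lemma length_run [simp]: "length (run step gs) = length gs"
  by (induction gs rule: rev_induct) auto

lemma nth_run_append: "j < length gs \<Longrightarrow> run step (gs @ hs) ! j = run step gs ! j"
proof (induction hs rule: rev_induct)
  case (snoc h hs)
  have "run step (gs @ hs @ [h]) = run step (gs @ hs) @ [step (run step (gs @ hs)) h]"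
    using run_snoc[of step "gs @ hs" h] by simp
  with snoc show ?case by (simp add: nth_append)
qed simp

lemma wire_ok_mono: "wire_ok J t w \<Longrightarrow> t \<le> t' \<Longrightarrow> wire_ok J t' w"
  by (cases w) auto

lemma wire_val_run_append:
  "wire_ok J (length gs) w \<Longrightarrow>
     wire_val inp cst (run step (gs @ hs)) w = wire_val inp cst (run step gs) w"
  by (cases w) (auto simp: nth_run_append)

lemma circuit_over_snoc:
  assumes "circuit_over J (gs, w)" "\<And>w'. w' \<in> set_conn c \<Longrightarrow> wire_ok J (length gs) w'"
  shows "circuit_over J (gs @ [c], Gate (length gs))"
  using assms by (auto simp: circuit_over_def nth_append less_Suc_eq)

text \<open>The claim is about extending an arbitrary gate list so that the circuit of a second
  operand can be appended to that of the first, whose wires keep their values.\<close>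

lemma gen_extend_circuit:
  fixes inp :: "nat \<Rightarrow> boolfun" and n M
  defines "step \<equiv> \<lambda>vs c. approx_conn M (map_conn (wire_val inp (const n) vs) c)"
  assumes "u \<in> gen n M (inp ` J)" "circuit_over J (gs, w0)"
  shows "\<exists>hs w. circuit_over J (gs @ hs, w) \<and> wire_val inp (const n) (run step (gs @ hs)) w = u"
  using assms(2,3)
proof (induction arbitrary: gs w0)
  case (gen_base f)
  then obtain j where "j \<in> J" "f = inp j" by blast
  with gen_base show ?case
    by (intro exI[of _ "[]"] exI[of _ "Inp j"]) (auto simp: circuit_over_def)
next
  case (gen_const b)
  then show ?case
    by (intro exI[of _ "[]"] exI[of _ "Const b"]) (auto simp: circuit_over_def)
next
  case (gen_mneg f)
  then obtain hs w where w: "circuit_over J (gs @ hs, w)"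
    "wire_val inp (const n) (run step (gs @ hs)) w = f" by blast
  have "circuit_over J ((gs @ hs) @ [Neg w], Gate (length (gs @ hs)))"
    using w(1) by (rule circuit_over_snoc) (use w(1) in \<open>auto simp: circuit_over_def\<close>)
  moreover have "wire_val inp (const n) (run step ((gs @ hs) @ [Neg w])) (Gate (length (gs @ hs))) = mneg M f"
    unfolding run_snoc using w(2) by (simp add: nth_append step_def)
  ultimately show ?case by (metis append.assoc)
next
  case (gen_mconj f g)
  obtain hs w where w: "circuit_over J (gs @ hs, w)"
    "wire_val inp (const n) (run step (gs @ hs)) w = f" using gen_mconj by blast
  obtain hs' w' where w': "circuit_over J ((gs @ hs) @ hs', w')"
    "wire_val inp (const n) (run step ((gs @ hs) @ hs')) w' = g" using gen_mconj.IH(2)[OF w(1)] by blast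
  let ?gs = "(gs @ hs) @ hs'"
  have ok: "wire_ok J (length (gs @ hs)) w" "wire_ok J (length ?gs) w'"
    using w(1) w'(1) by (auto simp: circuit_over_def)
  have "circuit_over J (?gs @ [Conj w w'], Gate (length ?gs))"
    using w'(1) by (rule circuit_over_snoc) (use ok in \<open>auto intro: wire_ok_mono\<close>)
  moreover have "wire_val inp (const n) (run step (?gs @ [Conj w w'])) (Gate (length ?gs)) = mconj M f g"
    unfolding run_snoc using w(2) w'(2) wire_val_run_append[OF ok(1), of inp "const n" step hs']
    by (simp add: nth_append step_def)
  ultimately show ?case by (metis append.assoc)
next
  case (gen_mdisj f g)
  obtain hs w where w: "circuit_over J (gs @ hs, w)"
    "wire_val inp (const n) (run step (gs @ hs)) w = f" using gen_mdisj by blast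
  obtain hs' w' where w': "circuit_over J ((gs @ hs) @ hs', w')"
    "wire_val inp (const n) (run step ((gs @ hs) @ hs')) w' = g" using gen_mdisj.IH(2)[OF w(1)] by blast
  let ?gs = "(gs @ hs) @ hs'"
  have ok: "wire_ok J (length (gs @ hs)) w" "wire_ok J (length ?gs) w'"
    using w(1) w'(1) by (auto simp: circuit_over_def)
  have "circuit_over J (?gs @ [Disj w w'], Gate (length ?gs))"
    using w'(1) by (rule circuit_over_snoc) (use ok in \<open>auto intro: wire_ok_mono\<close>)
  moreover have "wire_val inp (const n) (run step (?gs @ [Disj w w'])) (Gate (length ?gs)) = mdisj M f g"
    unfolding run_snoc using w(2) w'(2) wire_val_run_append[OF ok(1), of inp "const n" step hs']
    by (simp add: nth_append step_def)
  ultimately show ?case by (metis append.assoc)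
qed

lemma gen_approx_circuit:
  assumes "u \<in> gen n M ((!) fs ` J)"
  shows "\<exists>C. circuit_over J C \<and> approx_circuit n M fs C = u"
proof -
  have "circuit_over J ([], Const False)" by (simp add: circuit_over_def)
  from gen_extend_circuit[OF assms this] show ?thesis
    unfolding approx_circuit_def Let_def by (metis append_Nil fst_conv snd_conv)
qed

lemma projective_gen:
  assumes "projective n M" "set fs \<subseteq> members M" "u \<in> gen n M (set fs)"
    "z \<in> cube n" "y \<in> cube n" "\<forall>f\<in>set fs. z \<in> f \<longleftrightarrow> y \<in> f"
  shows "z \<in> u \<longleftrightarrow> y \<in> u"
proof -
  have "set fs = (!) fs ` {..<length fs}"
    by (auto simp: set_conv_nth)
  then obtain C where "circuit_over {..<length fs} C" "approx_circuit n M fs C = u"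
    using gen_approx_circuit[of u n M fs "{..<length fs}"] assms(3) by auto
  with assms show ?thesis unfolding projective_def by blast
qed

lemma zero_projective_gen:
  assumes "zero_projective n M" "J \<subseteq> {..<n}" "u \<in> gen n M (var n ` J)"
    "z \<in> cube n" "y \<in> cube n" "\<forall>j\<in>J. z ! j = y ! j"
  shows "z \<in> u \<longleftrightarrow> y \<in> u"
proof -
  have "var n ` J = (!) (map (var n) [0..<n]) ` J"
    using assms(2) by (intro image_cong) (auto simp: subset_iff)
  then obtain C where "circuit_over J C" "approx_circuit n M (map (var n) [0..<n]) C = u"
    using gen_approx_circuit[of u n M "map (var n) [0..<n]" J] assms(3) by auto
  with assms show ?thesis unfolding zero_projective_def by blast
qed

section \<open>Simulating oracle circuits\<close>

definition literal :: "nat \<Rightarrow> boolfun \<Rightarrow> bool" where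
  "literal n f \<longleftrightarrow> (\<exists>i<n. f = var n i \<or> f = cube n - var n i)"

context submodel
begin

definition approximable :: "nat \<Rightarrow> boolfun list \<Rightarrow> (bool list \<Rightarrow> bool) \<Rightarrow> bool" where
  "approximable L fs \<phi> \<longleftrightarrow> (\<exists>g\<in>G. \<exists>cs. tests cs \<and> length cs \<le> L \<and>
     (\<forall>z\<in>uncovered n M cs. z \<in> g \<longleftrightarrow> \<phi> (map (\<lambda>f. z \<in> f) fs)))"

text \<open>The last clause of the invariant records that negated inputs are represented exactly;
  for \<open>lit\<close> this is what makes the arguments of oracle gates literals. An ordinary gate
  costs one test, an oracle gate \<open>L\<close>.\<close>

lemma simulate:
  fixes lit :: bool
  assumes vars: "\<forall>i<n. var n i \<in> G"
    and C: "ocircuit_over {..<n} (gs, w0)"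
    and arity: "\<forall>\<phi> ws. Oracle \<phi> ws \<in> set gs \<longrightarrow> length ws = m"
    and literal: "lit \<longrightarrow> literal_oracles (gs, w0)"
    and approx: "\<forall>fs \<phi>. length fs = m \<longrightarrow> set fs \<subseteq> G \<longrightarrow> (lit \<longrightarrow> (\<forall>f\<in>set fs. literal n f)) \<longrightarrow>
                   approximable L fs \<phi>"
    and "t \<le> length gs"
  shows "\<exists>vs cs. length vs = t \<and> set vs \<subseteq> G \<and> tests cs \<and>
           length cs \<le> length (filter (\<lambda>g. \<not> is_oracle g) (take t gs))
                        + L * length (filter is_oracle (take t gs)) \<and>
           (\<forall>z\<in>uncovered n M cs. map (\<lambda>v. z \<in> v) vs = run (ogate_val z) (take t gs)) \<and>
           (\<forall>j<t. \<forall>i. gs ! j = Conn (Neg (Inp i)) \<longrightarrow> vs ! j = cube n - var n i)"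
  using \<open>t \<le> length gs\<close>
proof (induction t)
  case 0
  show ?case by (intro exI[of _ "[]"]) auto
next
  case (Suc t)
  then obtain vs cs where vs: "length vs = t" "set vs \<subseteq> G" "tests cs"
    "length cs \<le> length (filter (\<lambda>g. \<not> is_oracle g) (take t gs))
                  + L * length (filter is_oracle (take t gs))"
    "\<And>z. z \<in> uncovered n M cs \<Longrightarrow> map (\<lambda>v. z \<in> v) vs = run (ogate_val z) (take t gs)"
    "\<And>j i. j < t \<Longrightarrow> gs ! j = Conn (Neg (Inp i)) \<Longrightarrow> vs ! j = cube n - var n i"
    by auto
  have t: "t < length gs" using Suc.prems by simp
  then have tk: "take (Suc t) gs = take t gs @ [gs ! t]" by (simp add: take_Suc_conv_app_nth)
  define F where "F = wire_val (var n) (const n) vs"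
  have ok: "wire_ok {..<n} t w" if "w \<in> wires (gs ! t)" for w
    using C t that by (auto simp: ocircuit_over_def)
  have F_in: "F w \<in> G" if "wire_ok {..<n} t w" for w
    using that vars vs(1,2) by (cases w) (auto simp: F_def)
  have F_val: "z \<in> F w \<longleftrightarrow> wire_val ((!) z) id (run (ogate_val z) (take t gs)) w"
    if "wire_ok {..<n} t w" "z \<in> uncovered n M cs" for z w
  proof -
    have "z \<in> cube n" using that by (simp add: uncovered_def)
    then show ?thesis
      using that(1) vs(1) by (cases w) (auto simp: F_def var_def const_def simp flip: vs(5)[OF that(2)])
  qed
  have "\<exists>v\<in>G. \<exists>ds. tests ds \<and> length ds \<le> (if is_oracle (gs ! t) then L else 1) \<and>
      (\<forall>z\<in>uncovered n M (cs @ ds). z \<in> v \<longleftrightarrow> ogate_val z (run (ogate_val z) (take t gs)) (gs ! t)) \<and>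
      (\<forall>i. gs ! t = Conn (Neg (Inp i)) \<longrightarrow> v = cube n - var n i)"
  proof (cases "gs ! t")
    case (Conn c)
    define v where "v = approx_conn M (map_conn F c)"
    have c_in: "set_conn (map_conn F c) \<subseteq> G"
      using ok F_in by (auto simp: Conn conn.set_map)
    then have "v \<in> G" by (cases c) (auto simp: v_def)
    moreover have "z \<in> v \<longleftrightarrow> ogate_val z (run (ogate_val z) (take t gs)) (gs ! t)"
      if z: "z \<in> uncovered n M (cs @ [map_conn F c])" for z
    proof -
      have "z \<in> v \<longleftrightarrow> z \<in> exact_conn n (map_conn F c)"
        using z by (auto simp: uncovered_def error_set_def v_def)
      moreover have "z \<in> cube n" "z \<in> uncovered n M cs" using z by (auto simp: uncovered_def)
      ultimately show ?thesis
        using ok F_val by (cases c) (auto simp: Conn)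
    qed
    moreover have "v = cube n - var n i" if "gs ! t = Conn (Neg (Inp i))" for i
      using that Conn ok vars mneg_exact[of "var n i"] by (simp add: v_def F_def)
    ultimately show ?thesis
      using c_in by (intro bexI[of _ v] exI[of _ "[map_conn F c]"]) (auto simp: Conn)
  next
    case (Oracle \<phi> ws)
    have in_gs: "Oracle \<phi> ws \<in> set gs" using Oracle t by (metis nth_mem)
    have "literal n (F w)" if "lit" and w: "w \<in> set ws" for w
    proof -
      have "literal_wire (gs, w0) w"
        using literal \<open>lit\<close> in_gs w by (auto simp: literal_oracles_def)
      moreover have "wire_ok {..<n} t w" using ok Oracle w by simp
      ultimately show ?thesis
      proof (cases w)
        case (Inp i)
        with \<open>wire_ok {..<n} t w\<close> show ?thesis by (auto simp: literal_def F_def)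
      next
        case (Gate j)
        with \<open>literal_wire (gs, w0) w\<close> \<open>wire_ok {..<n} t w\<close> obtain i
          where j: "j < t" "gs ! j = Conn (Neg (Inp i))"
          by (auto simp: literal_wire_def)
        have "\<forall>w'\<in>wires (gs ! j). wire_ok {..<n} j w'"
          using C t j(1) by (simp add: ocircuit_over_def)
        then have "i < n" by (simp add: j(2))
        then show ?thesis using vs(6)[OF j] by (auto simp: literal_def F_def Gate)
      qed (auto simp: literal_wire_def)
    qed
    then have "approximable L (map F ws) \<phi>"
      using arity in_gs ok F_in Oracle by (intro approx[rule_format]) auto
    then obtain v ds where v: "v \<in> G" "tests ds" "length ds \<le> L"
      "\<And>z. z \<in> uncovered n M ds \<Longrightarrow> z \<in> v \<longleftrightarrow> \<phi> (map (\<lambda>f. z \<in> f) (map F ws))"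
      by (auto simp: approximable_def)
    have "z \<in> v \<longleftrightarrow> ogate_val z (run (ogate_val z) (take t gs)) (gs ! t)"
      if z: "z \<in> uncovered n M (cs @ ds)" for z
    proof -
      have "map (\<lambda>f. z \<in> f) (map F ws) = map (wire_val ((!) z) id (run (ogate_val z) (take t gs))) ws"
        using F_val ok z by (auto simp: Oracle)
      then show ?thesis using v(4)[of z] z by (simp only: Oracle ogate_val.simps uncovered_append)
    qed
    then show ?thesis
      using v by (intro bexI[of _ v] exI[of _ ds]) (auto simp: Oracle)
  qed
  then obtain v ds where v: "v \<in> G" "tests ds" "length ds \<le> (if is_oracle (gs ! t) then L else 1)"
    "\<And>z. z \<in> uncovered n M (cs @ ds) \<Longrightarrow>
       z \<in> v \<longleftrightarrow> ogate_val z (run (ogate_val z) (take t gs)) (gs ! t)"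
    "\<And>i. gs ! t = Conn (Neg (Inp i)) \<Longrightarrow> v = cube n - var n i"
    by blast
  show ?case
  proof (intro exI[of _ "vs @ [v]"] exI[of _ "cs @ ds"] conjI ballI allI impI)
    show "length (cs @ ds) \<le> length (filter (\<lambda>g. \<not> is_oracle g) (take (Suc t) gs))
        + L * length (filter is_oracle (take (Suc t) gs))"
      using vs(4) v(3) by (auto simp: tk split: if_splits)
    fix z assume "z \<in> uncovered n M (cs @ ds)"
    then show "map (\<lambda>v. z \<in> v) (vs @ [v]) = run (ogate_val z) (take (Suc t) gs)"
      using vs(5)[of z] v(4)[of z] by (simp add: tk)
  next
    fix j i assume "j < Suc t" "gs ! j = Conn (Neg (Inp i))"
    then show "(vs @ [v]) ! j = cube n - var n i"
      using vs(1,6) v(5) by (auto simp: nth_append less_Suc_eq)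
  qed (use vs v in auto)
qed

end

section \<open>From simulation to size lower bounds\<close>

lemma rho_le:
  assumes "\<And>c. c \<in> set cs \<Longrightarrow> set_conn c \<subseteq> members M" "g \<in> members M"
    "sym_diff f g \<subseteq> (\<Union>c \<in> set cs. error_set n M c)"
  shows "rho n f M \<le> enat (length cs)"
  unfolding rho_def using assms by (intro Inf_lower) blast

lemma oracle_circuit_size:
  fixes lit :: bool
  assumes M: "legitimate n M" "exact_neg n M"
    and rho: "enat s \<le> rho n f M"
    and C: "oracle_circuit n k m C" "computes n C f" "lit \<longrightarrow> literal_oracles C"
    and approx: "\<forall>fs \<phi>. length fs = m \<longrightarrow> set fs \<subseteq> members M \<longrightarrow>
                   (lit \<longrightarrow> (\<forall>f\<in>set fs. literal n f)) \<longrightarrow> submodel.approximable n M (members M) L fs \<phi>"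
    and "k \<ge> 1"
  shows "\<not> int (size_of C) \<le> int s - int (k * L)"
proof -
  interpret submodel n M "members M" using M by (rule submodel_members)
  obtain gs w where C_eq: "C = (gs, w)" by (cases C)
  have over: "ocircuit_over {..<n} (gs, w)" and k: "length (filter is_oracle gs) = k"
    and arity: "\<forall>\<phi> ws. Oracle \<phi> ws \<in> set gs \<longrightarrow> length ws = m"
    using C(1) by (auto simp: oracle_circuit_def C_eq)
  have vars: "\<forall>i<n. var n i \<in> members M"
    using M by (simp add: legitimate_def)
  obtain vs cs where vs: "length vs = length gs" "set vs \<subseteq> members M" "tests cs"
    "length cs \<le> length (filter (\<lambda>g. \<not> is_oracle g) gs) + L * length (filter is_oracle gs)"
    "\<And>z. z \<in> uncovered n M cs \<Longrightarrow> map (\<lambda>v. z \<in> v) vs = run (ogate_val z) gs"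
    using simulate[OF vars over arity C(3)[unfolded C_eq] approx order_refl] by auto
  define g where "g = wire_val (var n) (const n) vs w"
  have w: "wire_ok {..<n} (length gs) w" using over by (simp add: ocircuit_over_def)
  then have g: "g \<in> members M"
    using vars vs(1,2) by (cases w) (auto simp: g_def)
  have g_val: "z \<in> g \<longleftrightarrow> z \<in> f" if z: "z \<in> uncovered n M cs" for z
  proof -
    have "z \<in> cube n" using z by (simp add: uncovered_def)
    then have "z \<in> g \<longleftrightarrow> ocircuit_val C z"
      using w vs(1)
      by (cases w) (auto simp: g_def ocircuit_val_def C_eq var_def const_def simp flip: vs(5)[OF z])
    with C(2) \<open>z \<in> cube n\<close> show ?thesis by (auto simp: computes_def)
  qed
  have "f \<subseteq> cube n" "g \<subseteq> cube n"
    using C(2) g M by (auto simp: computes_def legitimate_def boolfuns_def)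
  have "sym_diff f g \<subseteq> (\<Union>c \<in> set cs. error_set n M c)"
  proof
    fix z assume z: "z \<in> sym_diff f g"
    then have "z \<notin> uncovered n M cs" using g_val by blast
    moreover have "z \<in> cube n" using z \<open>f \<subseteq> cube n\<close> \<open>g \<subseteq> cube n\<close> by blast
    ultimately show "z \<in> (\<Union>c \<in> set cs. error_set n M c)" by (simp add: uncovered_def)
  qed
  with vs(3) g have "rho n f M \<le> enat (length cs)"
    by (intro rho_le) (auto simp: tests_def)
  with rho have "s \<le> length cs" using order_trans enat_ord_simps(1) by blast
  \<comment> \<open>Only \<open>size_of C - k\<close> gates are ordinary. The surplus
    \<open>k \<ge> 1\<close> makes the final inequality strict, so equality is excluded too.\<close>
  then have "s + k \<le> size_of C + k * L"
    using vs(4) k sum_length_filter_compl[of is_oracle gs]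
    by (simp add: size_of_def C_eq mult.commute)
  then have "int s + int k \<le> int (size_of C) + int (k * L)"
    by (metis of_nat_add of_nat_mono)
  with \<open>k \<ge> 1\<close> show ?thesis by linarith
qed

section \<open>The cost of an oracle gate in the three settings\<close>

lemma approximable_general:
  assumes "legitimate n M" "exact_neg n M" "n \<ge> 1" "m \<ge> 1" "length fs = m" "set fs \<subseteq> members M"
  shows "submodel.approximable n M (members M) (228 * n * m) fs \<phi>"
proof -
  interpret submodel n M "members M" using assms(1,2) by (rule submodel_members)
  show ?thesis
    unfolding approximable_def assms(5)[symmetric] using assms
    \<comment> \<open>Every point represents itself, hence \<open>N = n\<close>.\<close>
    by (intro approximation_ex[of fs n "cube n"]) (auto simp: finite_cube card_cube)
qed

text \<open>The construction runs inside \<open>gen n M B\<close>, where invariance limits the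
  number of point classes; its result and tests are then read as members of the full model.\<close>

lemma approximable_invariant:
  assumes M: "legitimate n M" "exact_neg n M"
    and fs: "m \<ge> 1" "length fs = m" "set fs \<subseteq> gen n M B" "B \<subseteq> members M"
    and inv: "\<And>u z y. u \<in> gen n M B \<Longrightarrow> z \<in> cube n \<Longrightarrow> y \<in> cube n \<Longrightarrow>
                \<forall>f\<in>set fs. z \<in> f \<longleftrightarrow> y \<in> f \<Longrightarrow> z \<in> u \<longleftrightarrow> y \<in> u"
  shows "submodel.approximable n M (members M) (228 * m * m) fs \<phi>"
proof -
  interpret A: submodel n M "members M" using M by (rule submodel_members)
  interpret B: submodel n M "gen n M B" using M fs(4) by (rule submodel_gen)
  have "fs \<noteq> []" using fs by auto
  from B.approximation_ex_invariant[OF fs(3) this inv, of \<phi>]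
  obtain g cs where "g \<in> gen n M B" "B.tests cs" "length cs \<le> 228 * m * m"
    "\<forall>z\<in>uncovered n M cs. z \<in> g \<longleftrightarrow> \<phi> (map (\<lambda>f. z \<in> f) fs)"
    unfolding fs(2) by blast
  moreover have "gen n M B \<subseteq> members M" using M(1) fs(4) by (rule gen_subset_members)
  ultimately show ?thesis
    unfolding A.approximable_def A.tests_def B.tests_def by blast
qed

lemma approximable_projective:
  assumes "legitimate n M" "exact_neg n M" "projective n M" "m \<ge> 1" "length fs = m"
    "set fs \<subseteq> members M"
  shows "submodel.approximable n M (members M) (228 * m * m) fs \<phi>"
proof (rule approximable_invariant[OF assms(1,2,4,5) _ assms(6)])
  show "set fs \<subseteq> gen n M (set fs)" by (auto intro: gen_base)
  show "z \<in> u \<longleftrightarrow> y \<in> u" if "u \<in> gen n M (set fs)" "z \<in> cube n" "y \<in> cube n"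
    "\<forall>f\<in>set fs. z \<in> f \<longleftrightarrow> y \<in> f" for u z y
    using projective_gen[OF assms(3,6)] that by blast
qed

lemma approximable_zero_projective:
  assumes M: "legitimate n M" "exact_neg n M" "zero_projective n M" and "m \<ge> 1" "length fs = m"
    and lit: "\<forall>f\<in>set fs. literal n f"
  shows "submodel.approximable n M (members M) (228 * m * m) fs \<phi>"
proof -
  \<comment> \<open>0-projectivity concerns circuits on variables, so the generators are the
    variables underlying the literals. Exact negation recovers the literals, and equal literal
    values force equal coordinates in \<open>J\<close>.\<close>
  define J where "J = {i. i < n \<and> (var n i \<in> set fs \<or> cube n - var n i \<in> set fs)}"
  have vars: "var n i \<in> members M" if "i < n" for i
    using M that by (simp add: legitimate_def)
  show ?thesis
  proof (rule approximable_invariant[OF M(1,2) assms(4,5)])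
    show "var n ` J \<subseteq> members M" using vars by (auto simp: J_def)
    show "set fs \<subseteq> gen n M (var n ` J)"
    proof
      fix f assume f: "f \<in> set fs"
      with lit obtain i where i: "i < n" "f = var n i \<or> f = cube n - var n i"
        by (auto simp: literal_def)
      with f have "var n i \<in> gen n M (var n ` J)" by (auto simp: J_def intro: gen_base)
      moreover have "mneg M (var n i) = cube n - var n i"
        using M(2) vars[OF i(1)] by (simp add: exact_neg_def)
      ultimately show "f \<in> gen n M (var n ` J)"
        using i(2) gen_mneg by metis
    qed
    fix u z y assume u: "u \<in> gen n M (var n ` J)" and zy: "z \<in> cube n" "y \<in> cube n"
      and eq: "\<forall>f\<in>set fs. z \<in> f \<longleftrightarrow> y \<in> f"
    have "z ! j = y ! j" if "j \<in> J" for j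
    proof -
      have "var n j \<in> set fs \<or> cube n - var n j \<in> set fs"
        using that by (simp add: J_def)
      then have "z \<in> var n j \<longleftrightarrow> y \<in> var n j"
      proof
        assume "cube n - var n j \<in> set fs"
        with eq have "z \<in> cube n - var n j \<longleftrightarrow> y \<in> cube n - var n j" by (rule bspec)
        with zy show ?thesis by simp
      qed (rule bspec[OF eq])
      with zy show ?thesis by (simp add: var_def)
    qed
    then show "z \<in> u \<longleftrightarrow> y \<in> u"
      using zero_projective_gen[OF M(3) _ u zy] by (simp add: J_def subset_iff)
  qed
qed

text \<open>The general approximation needs \<open>n \<ge> 1\<close>. For \<open>n = 0\<close> every
  function is constant, hence a member, and \<open>rho\<close> cannot reach a positive
  \<open>s\<close>.\<close>

lemma rho_dimension_zero:
  assumes "legitimate 0 M" "f \<in> boolfuns 0"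
  shows "rho 0 f M = 0"
proof -
  have "f = const 0 ([] \<in> f)"
    using assms(2) by (auto simp: boolfuns_def cube_def const_def)
  then have "f \<in> members M" using assms(1) by (metis legitimate_def)
  then have "rho 0 f M \<le> enat (length ([] :: boolfun conn list))" by (intro rho_le[where g = f]) auto
  then show ?thesis by (simp add: zero_enat_def[symmetric])
qed

theorem theorem3:
  "\<exists>K::nat. \<forall>(n::nat) (M::model) (f::boolfun) (s::nat) (k::nat) (m::nat).
     legitimate n M \<longrightarrow> exact_neg n M \<longrightarrow> f \<in> boolfuns n \<longrightarrow>
     s \<ge> 1 \<longrightarrow> k \<ge> 1 \<longrightarrow> m \<ge> 1 \<longrightarrow>
       (rho n f M \<ge> enat s \<longrightarrow>
          \<not> (\<exists>C. oracle_circuit n k m C \<and> int (size_of C) \<le> int s - int (K * k * n * m) \<and>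
                 computes n C f)) \<and>
       (rho n f M \<ge> enat s \<and> zero_projective n M \<longrightarrow>
          \<not> (\<exists>C. oracle_circuit n k m C \<and> literal_oracles C \<and>
                 int (size_of C) \<le> int s - int (K * k * m ^ 2) \<and> computes n C f)) \<and>
       (rho n f M \<ge> enat s \<and> projective n M \<longrightarrow>
          \<not> (\<exists>C. oracle_circuit n k m C \<and> int (size_of C) \<le> int s - int (K * k * m ^ 2) \<and>
                 computes n C f))"
proof (intro exI[of _ 228] allI impI, goal_cases)
  case (1 n M f s k m)
  then have M: "legitimate n M" "exact_neg n M" by simp_all
  show ?case
  proof (intro conjI impI notI; elim exE conjE)
    fix C
    assume rho: "enat s \<le> rho n f M" and C: "oracle_circuit n k m C" "computes n C f"
      and size: "int (size_of C) \<le> int s - int (228 * k * n * m)"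
    have "n \<ge> 1"
    proof (rule ccontr)
      assume "\<not> n \<ge> 1"
      then have "rho n f M = 0" using 1 rho_dimension_zero by (simp add: not_le)
      with rho \<open>1 \<le> s\<close> show False by (simp add: zero_enat_def)
    qed
    have "\<not> int (size_of C) \<le> int s - int (k * (228 * n * m))"
      using approximable_general[OF M \<open>n \<ge> 1\<close> \<open>1 \<le> m\<close>]
      by (intro oracle_circuit_size[OF M rho C, where lit = False] \<open>1 \<le> k\<close>) auto
    with size show False by (simp add: mult_ac)
  next
    fix C
    assume rho: "enat s \<le> rho n f M" and C: "oracle_circuit n k m C" "computes n C f"
      and zp: "zero_projective n M" and "literal_oracles C"
      and size: "int (size_of C) \<le> int s - int (228 * k * m ^ 2)"
    then have "\<not> int (size_of C) \<le> int s - int (k * (228 * m * m))"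
      using approximable_zero_projective[OF M zp \<open>1 \<le> m\<close>]
      by (intro oracle_circuit_size[OF M rho C, where lit = True] \<open>1 \<le> k\<close>) auto
    with size show False by (simp add: mult_ac power2_eq_square)
  next
    fix C
    assume rho: "enat s \<le> rho n f M" and C: "oracle_circuit n k m C" "computes n C f"
      and p: "projective n M"
      and size: "int (size_of C) \<le> int s - int (228 * k * m ^ 2)"
    have "\<not> int (size_of C) \<le> int s - int (k * (228 * m * m))"
      using approximable_projective[OF M p \<open>1 \<le> m\<close>]
      by (intro oracle_circuit_size[OF M rho C, where lit = False] \<open>1 \<le> k\<close>) auto
    with size show False by (simp add: mult_ac power2_eq_square)
  qed
qed

end
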